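(* Let $d>0$ and $\kappa_{max}\ge 0$ satisfy $d\kappa_{max}<1$, and put $\beta_M:=\frac{1-d\kappa_{max}}{d}$. For all real numbers $C_1,\beta$ with $$0<C_1\le \frac{d\beta_M}{2},\qquad 0<\beta\le\frac{\beta_M}{2},$$ there exist positive constants $M, C_0, C_2,\rho$ such that, for every curvature function $\kappa_r:[0,\infty)\to\mathbb{R}$ with $|\kappa_r(t)|\le\kappa_{max}$ for all $t\ge 0$, the closed-loop system with state $(y_1,y_2,\xi)\in\mathbb{R}^3$ $$\begin{aligned}\dot y_1&=-C_1\sigma(My_1)+\lambda(t)\,y_2+(\cos\xi-1),\\ \dot y_2&=\sin\xi-\lambda(t)\,y_1,\\ \dot\xi&=-\beta\,\sigma\!\left(\frac{C_0}{\beta}\bigl[\xi+\rho\,\sigma(C_2y_2)\bigr]\right),\end{aligned}$$ where $\lambda(t):=(1+u_1)\kappa_r(t)$ and $u_1:=C_1\sigma(My_1)$, is globally asymptotically stable with respect to the origin.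
   Context: The standard saturation function is $\sigma(x)=\frac{x}{\max(1,|x|)}$ for $x\in\mathbb{R}$. The system is the error dynamics $\dot y_1=-u_1+(\cos\xi-1)+(1+u_1)\kappa_r y_2$, $\dot y_2=\sin\xi-(1+u_1)\kappa_r y_1$, $\dot\xi=u_2$ in closed loop with the feedback controls $u_1=C_1\sigma(My_1)$ and $u_2=\beta\sigma\left(-\frac{C_0}{\beta}[\xi+\rho\sigma(C_2y_2)]\right)$. Here $\xi$ is a real-valued (not modulo $2\pi$) variable. The function $\kappa_r$ (the curvature, as a function of time, of the path to be followed) is a measurable function of time, and solutions are understood in the usual (Carathéodory) sense. Globally asymptotically stable with respect to the origin means: all solutions are defined for all future times; the origin is Lyapunov stable (for every initial time $\tau\ge0$ and every $\varepsilon>0$ there is $\delta>0$ such that every solution with $\|(y_1,y_2,\xi)(\tau)\|<\delta$ satisfies $\|(y_1,y_2,\xi)(t)\|<\varepsilon$ for all $t\ge\tau$); and every solution, from any initial condition in $\mathbb{R}^3$, tends to the origin as $t\to\infty$. *)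

theory Defs
  imports "HOL-Analysis.Analysis"
begin

text \<open>A finite set of pairs \<open>(a, b)\<close> represents a finite family of non-overlapping
  closed intervals contained in \<open>S\<close>.\<close>

definition abs_continuous_on :: "real set \<Rightarrow> (real \<Rightarrow> 'a::real_normed_vector) \<Rightarrow> bool" where
  "abs_continuous_on S x \<longleftrightarrow>
     (\<forall>\<epsilon>>0. \<exists>\<delta>>0. \<forall>D. finite D \<longrightarrow>
        (\<forall>(a, b)\<in>D. a \<le> b \<and> {a..b} \<subseteq> S) \<longrightarrow>
        pairwise (\<lambda>(a, b) (c, d). {a<..<b} \<inter> {c<..<d} = {}) D \<longrightarrow>
        (\<Sum>(a, b)\<in>D. b - a) < \<delta> \<longrightarrow>
        (\<Sum>(a, b)\<in>D. norm (x b - x a)) < \<epsilon>)"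

definition caratheodory_solution ::
  "(real \<Rightarrow> 'a::real_normed_vector \<Rightarrow> 'a) \<Rightarrow> real set \<Rightarrow> (real \<Rightarrow> 'a) \<Rightarrow> bool" where
  "caratheodory_solution f J x \<longleftrightarrow>
     is_interval J \<and>
     (\<forall>a b. {a..b} \<subseteq> J \<longrightarrow> abs_continuous_on {a..b} x) \<and>
     (AE t in lebesgue. t \<in> J \<longrightarrow> (x has_vector_derivative f t (x t)) (at t within J))"

text \<open>In the next definition, \<open>J\<close> is an arbitrary interval with left endpoint \<open>\<tau>\<close>, open or closed
  on the right. The case \<open>J = {\<tau>}\<close> says that every initial condition at time \<open>\<tau>\<close> admits a global
  forward solution; the other cases say that no solution ceases to exist in finite time.\<close>

definition forward_complete :: "(real \<Rightarrow> 'a::real_normed_vector \<Rightarrow> 'a) \<Rightarrow> bool" where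
  "forward_complete f \<longleftrightarrow>
     (\<forall>\<tau>\<ge>0. \<forall>J x. \<tau> \<in> J \<longrightarrow> J \<subseteq> {\<tau>..} \<longrightarrow> caratheodory_solution f J x \<longrightarrow>
        (\<exists>z. caratheodory_solution f {\<tau>..} z \<and> (\<forall>t\<in>J. z t = x t)))"

definition lyapunov_stable :: "(real \<Rightarrow> 'a::real_normed_vector \<Rightarrow> 'a) \<Rightarrow> bool" where
  "lyapunov_stable f \<longleftrightarrow>
     (\<forall>\<tau>\<ge>0. \<forall>\<epsilon>>0. \<exists>\<delta>>0. \<forall>x. caratheodory_solution f {\<tau>..} x \<longrightarrow>
        norm (x \<tau>) < \<delta> \<longrightarrow> (\<forall>t\<ge>\<tau>. norm (x t) < \<epsilon>))"

definition globally_attractive :: "(real \<Rightarrow> 'a::real_normed_vector \<Rightarrow> 'a) \<Rightarrow> bool" where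
  "globally_attractive f \<longleftrightarrow>
     (\<forall>\<tau>\<ge>0. \<forall>x. caratheodory_solution f {\<tau>..} x \<longrightarrow> (x \<longlongrightarrow> 0) at_top)"

definition globally_asymptotically_stable ::
  "(real \<Rightarrow> 'a::real_normed_vector \<Rightarrow> 'a) \<Rightarrow> bool" where
  "globally_asymptotically_stable f \<longleftrightarrow>
     forward_complete f \<and> lyapunov_stable f \<and> globally_attractive f"

definition sat :: "real \<Rightarrow> real" where
  "sat x = x / max 1 \<bar>x\<bar>"

text \<open>The state is \<open>(y\<^sub>1, y\<^sub>2, \<xi>)\<close>; the product norm on \<^typ>\<open>real \<times> real \<times> real\<close> is the
  Euclidean norm. Since \<^const>\<open>sat\<close> is odd, the last component is the control
  \<open>u\<^sub>2 = \<beta> sat (- (C0 / \<beta>) (\<xi> + \<rho> sat (C2 y\<^sub>2)))\<close>.\<close>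

definition closed_loop ::
  "real \<Rightarrow> real \<Rightarrow> real \<Rightarrow> real \<Rightarrow> real \<Rightarrow> real \<Rightarrow> (real \<Rightarrow> real) \<Rightarrow>
   real \<Rightarrow> real \<times> real \<times> real \<Rightarrow> real \<times> real \<times> real" where
  "closed_loop C1 \<beta> M C0 C2 \<rho> \<kappa> t = (\<lambda>(y1, y2, \<xi>).
     let u1 = C1 * sat (M * y1);
         lam = (1 + u1) * \<kappa> t
     in (- u1 + lam * y2 + (cos \<xi> - 1),
         sin \<xi> - lam * y1,
         - \<beta> * sat (C0 / \<beta> * (\<xi> + \<rho> * sat (C2 * y2)))))"

end

(*
  Take C0 = 1 and rho small. While |xi| >= 2 rho, the feedback drives xi towards 0 at a speed bounded
  away from 0, so |xi| <= 2 rho after a finite time and for ever; from then on u2 is unsaturated and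
  xi' = - (xi + rho sat (C2 y2)). Let V = (y1^2 + (y2 + xi)^2 + xi^2) / 2. In V' the rotation by lam leaves
  only - lam y1 xi, and the cross term y2 xi of V turns y2 sin xi into - rho y2 sat (C2 y2); the remaining
  terms are dominated once C2 = 1 / (8 rho) and M is large. Hence V' <= - W with W positive definite and
  independent of time. V is comparable to the squared norm, which gives stability, and W is bounded below
  by a multiple of V on bounded sets, which gives attractivity. Completeness follows from the linear growth
  of the field: local solutions exist on time intervals whose length does not depend on the initial state.
*)

theory Submission
  imports Defs
begin

section \<open>Absolutely continuous functions\<close>

text \<open>Since \<open>\<kappa>\<close> is merely measurable, nothing is known of
  \<open>lam\<close> beyond the bound \<open>L\<close>: whatever it multiplies must cancel in V' or
  be dominated for every value in [-L, L]. The equal weights of y1 and y2 make lam y1 y2 cancel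
  exactly. The rest is delicate because the damping y sat (k y) is quadratic near 0 but only linear
  far out, so the cross terms in y1 and in y2 have to be beaten in two regimes: near 0 by a large
  gain and Young's inequality, far out by the smallness of |xi|. Hence xi is confined first, and
  hence the condition \<open>4 * \<rho> * (1 + L) \<le> C1\<close>. The same irregularity leaves
  trajectories only absolutely continuous, so every decrease of a quantity in time rests on the
  fundamental theorem of calculus for such functions. It is proved for the gauge integral, where
  integrability of the derivative is a conclusion and not an assumption. Conversely, solutions are
  built from the integral equation and differentiated almost everywhere by Lebesgue's
  theorem.\<close>

text \<open>The gauge treats two kinds of tags differently. Outside \<open>N\<close> the derivative
  controls the increment over a small interval. Tags in \<open>N\<close> have their intervals inside
  an open set of measure below \<open>\<delta>\<close>, where absolute continuity bounds the total
  increment; the integrand is set to 0 there and contributes nothing.\<close>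

lemma abs_continuous_on_has_integral:
  fixes x g :: "real \<Rightarrow> 'a::banach"
  assumes "a \<le> b" and ac: "abs_continuous_on {a..b} x" and N: "negligible N"
    and deriv: "\<And>t. t \<in> {a..b} - N \<Longrightarrow> (x has_vector_derivative g t) (at t within {a..b})"
  shows "(g has_integral (x b - x a)) {a..b}"
proof -
  define g' where "g' t = (if t \<in> N then 0 else g t)" for t
  have "(g' has_integral (x b - x a)) {a..b}"
    unfolding has_integral_real
  proof (intro allI impI)
    fix e :: real assume "e > 0"
    \<comment> \<open>The summand 1 keeps \<open>e1\<close> positive when \<open>a = b\<close>; all
      that is needed later is e1 (b - a) <= e / 2.\<close>
    define e1 where "e1 = e / (2 * (b - a + 1))"
    have "e1 > 0" using \<open>e > 0\<close> \<open>a \<le> b\<close> by (simp add: e1_def)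
    have "e / 2 > 0" using \<open>e > 0\<close> by simp
    from ac[unfolded abs_continuous_on_def, THEN spec, THEN mp, OF this] obtain \<delta> where "\<delta> > 0" and
      \<delta>0: "\<forall>D. finite D \<longrightarrow> (\<forall>(u, v)\<in>D. u \<le> v \<and> {u..v} \<subseteq> {a..b}) \<longrightarrow>
        pairwise (\<lambda>(u, v) (c, d). {u<..<v} \<inter> {c<..<d} = {}) D \<longrightarrow>
        (\<Sum>(u, v)\<in>D. v - u) < \<delta> \<longrightarrow> (\<Sum>(u, v)\<in>D. norm (x v - x u)) < e / 2"
      by (elim exE conjE)
    note \<delta> = \<delta>0[THEN spec, THEN mp, THEN mp, THEN mp, THEN mp]
    have N0: "N \<in> null_sets lebesgue" using N negligible_iff_null_sets by blast
    then obtain U where U: "open U" "N \<subseteq> U" "U - N \<in> lmeasurable" "emeasure lebesgue (U - N) < ennreal \<delta>"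
      using sets_lebesgue_outer_open[of N \<delta>] \<open>\<delta> > 0\<close> by (auto simp: null_sets_def)
    have UN: "U = (U - N) \<union> N" using U by auto
    have "emeasure lebesgue U = emeasure lebesgue (U - N)"
      by (subst UN, rule emeasure_Un_null_set) (use U(3) N0 in auto)
    with U(4) have eU: "emeasure lebesgue U < ennreal \<delta>" by simp
    then have Ulm: "U \<in> lmeasurable"
      using U(1) by (auto simp: fmeasurable_def intro: order_less_trans)
    have mU: "measure lebesgue U < \<delta>"
      using eU \<open>\<delta> > 0\<close> Ulm by (simp add: emeasure_eq_measure2 ennreal_less_iff)
    have "\<forall>t. \<exists>d>0. (t \<in> N \<longrightarrow> ball t d \<subseteq> U) \<and> (t \<in> {a..b} - N \<longrightarrow>
        (\<forall>y\<in>{a..b}. \<bar>y - t\<bar> < d \<longrightarrow> norm (x y - x t - (y - t) *\<^sub>R g t) \<le> e1 * \<bar>y - t\<bar>))"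
    proof
      fix t
      consider "t \<in> N" | "t \<in> {a..b} - N" | "t \<notin> N" "t \<notin> {a..b}" by blast
      then show "\<exists>d>0. (t \<in> N \<longrightarrow> ball t d \<subseteq> U) \<and> (t \<in> {a..b} - N \<longrightarrow>
        (\<forall>y\<in>{a..b}. \<bar>y - t\<bar> < d \<longrightarrow> norm (x y - x t - (y - t) *\<^sub>R g t) \<le> e1 * \<bar>y - t\<bar>))"
      proof cases
        case 1
        then have "t \<in> U" using U by blast
        with \<open>open U\<close> obtain d where "d > 0" "ball t d \<subseteq> U" using open_contains_ball by metis
        with 1 show ?thesis by blast
      next
        case 2
        from deriv[OF this] \<open>e1 > 0\<close> 2 show ?thesis
          unfolding has_vector_derivative_def has_derivative_within_alt by simp
      next
        case 3 then show ?thesis using zero_less_one by blast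
      qed
    qed
    then obtain r where r: "\<And>t. r t > 0" "\<And>t. t \<in> N \<Longrightarrow> ball t (r t) \<subseteq> U"
      "\<And>t y. t \<in> {a..b} - N \<Longrightarrow> y \<in> {a..b} \<Longrightarrow> \<bar>y - t\<bar> < r t \<Longrightarrow>
          norm (x y - x t - (y - t) *\<^sub>R g t) \<le> e1 * \<bar>y - t\<bar>" by metis
    define \<gamma> where "\<gamma> t = ball t (r t)" for t
    have gauge: "gauge \<gamma>" using r(1) by (auto simp: gauge_def \<gamma>_def)
    have main: "norm ((\<Sum>(t, K)\<in>D. measure lborel K *\<^sub>R g' t) - (x b - x a)) < e"
      if D: "D tagged_division_of {a..b}" and fine: "\<gamma> fine D" for D
    proof -
      have fin: "finite D" using D by blast
      define F where "F = (\<lambda>(t::real, K). measure lborel K *\<^sub>R g' t - (x (Sup K) - x (Inf K)))"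
      have KI: "K = {Inf K..Sup K} \<and> Inf K \<le> t \<and> t \<le> Sup K \<and> a \<le> Inf K \<and> Sup K \<le> b \<and>
          measure lborel K = Sup K - Inf K \<and> K \<subseteq> ball t (r t)" if tK: "(t, K) \<in> D" for t K
      proof -
        obtain u v where uv: "K = {u..v}" using tagged_division_ofD(4)[OF D tK] by auto
        have "t \<in> K" "K \<subseteq> {a..b}" using tagged_division_ofD(2,3)[OF D tK] by auto
        moreover have "K \<subseteq> ball t (r t)" using fine tK by (auto simp: fine_def \<gamma>_def)
        ultimately show ?thesis using uv by auto
      qed
      have KI_le: "Inf K \<le> Sup K" if "(t, K) \<in> D" for t K
        using KI[OF that] by linarith
      have "(\<Sum>(t, K)\<in>D. measure lborel K *\<^sub>R g' t) - (x b - x a) = sum F D"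
        unfolding F_def additive_tagged_division_1[OF \<open>a \<le> b\<close> D, of x, symmetric]
        by (simp add: sum_subtractf case_prod_unfold)
      also have "norm \<dots> \<le> (\<Sum>p\<in>D. norm (F p))" by (rule norm_sum)
      also have "\<dots> = (\<Sum>p\<in>{p\<in>D. fst p \<in> N}. norm (F p)) + (\<Sum>p\<in>{p\<in>D. fst p \<notin> N}. norm (F p))"
        by (subst sum.union_disjoint[symmetric]) (auto simp: fin intro!: sum.cong)
      also have "\<dots> < e / 2 + e / 2"
      proof (rule add_less_le_mono)
        define B where "B = {p\<in>D. fst p \<in> N}"
        define h where "h p = (Inf (snd p), Sup (snd p))" for p :: "real \<times> real set"
        have finB: "finite B" using fin by (simp add: B_def)
        have inter: "{Inf (snd p)<..<Sup (snd p)} \<inter> {Inf (snd q)<..<Sup (snd q)} = {}"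
          if "p \<in> B" "q \<in> B" "p \<noteq> q" for p q
        proof -
          obtain t K s J where pq: "p = (t, K)" "q = (s, J)" by fastforce
          with that have tK: "(t, K) \<in> D" "(s, J) \<in> D" "(t, K) \<noteq> (s, J)" by (auto simp: B_def)
          have "interior K \<inter> interior J = {}" using tagged_division_ofD(5)[OF D tK(1,2)] tK(3) by blast
          moreover have "interior K = {Inf K<..<Sup K}" "interior J = {Inf J<..<Sup J}"
            using KI[OF tK(1)] KI[OF tK(2)] by (metis interior_atLeastAtMost_real)+
          ultimately show ?thesis by (simp add: pq)
        qed
        \<comment> \<open>\<open>abs_continuous_on\<close> takes a set of end point pairs, so tagged
          intervals with the same end points get merged by \<open>h\<close>. Disjoint interiors
          force merged intervals to be degenerate, and there \<open>f\<close> vanishes.\<close>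
        have sumB: "sum f (h ` B) = (\<Sum>p\<in>B. f (h p))" if "\<And>u. f (u, u) = 0" for f :: "real \<times> real \<Rightarrow> real"
        proof (subst sum.reindex_nontrivial[OF finB])
          fix p q assume pq: "p \<in> B" "q \<in> B" "p \<noteq> q" "h p = h q"
          have "{Inf (snd p)<..<Sup (snd p)} = {}" using inter[OF pq(1-3)] pq(4) by (auto simp: h_def)
          moreover have "Inf (snd p) \<le> Sup (snd p)"
            using KI[of "fst p" "snd p"] pq(1) by (auto simp: B_def)
          ultimately show "f (h p) = 0" using that by (simp add: h_def)
        qed auto
        have "(\<Sum>(u, v)\<in>h ` B. v - u) = (\<Sum>p\<in>B. Sup (snd p) - Inf (snd p))"
          by (subst sumB) (auto simp: h_def)
        also have "\<dots> = (\<Sum>p\<in>B. measure lebesgue {Inf (snd p)<..<Sup (snd p)})"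
          by (intro sum.cong) (auto simp: B_def dest: KI_le)
        also have "\<dots> = measure lebesgue (\<Union>p\<in>B. {Inf (snd p)<..<Sup (snd p)})"
          by (rule measure_UNION'[symmetric]) (use finB inter in \<open>auto simp: pairwise_def disjnt_def\<close>)
        also have "\<dots> \<le> measure lebesgue U"
        proof (rule measure_mono_fmeasurable[OF _ _ Ulm])
          show "(\<Union>p\<in>B. {Inf (snd p)<..<Sup (snd p)}) \<subseteq> U"
          proof clarify
            fix t K s assume "(t, K) \<in> B" and s: "s \<in> {Inf (snd (t, K))<..<Sup (snd (t, K))}"
            then have tK: "(t, K) \<in> D" "t \<in> N" by (auto simp: B_def)
            have "s \<in> K" using s KI[OF tK(1)] by (metis atLeastAtMost_iff greaterThanLessThan_iff less_imp_le snd_conv)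
            then show "s \<in> U" using KI[OF tK(1)] r(2)[OF tK(2)] by blast
          qed
          show "(\<Union>p\<in>B. {Inf (snd p)<..<Sup (snd p)}) \<in> sets lebesgue"
            by (rule sets.finite_UN) (use finB in auto)
        qed
        also note mU
        finally have "(\<Sum>(u, v)\<in>h ` B. v - u) < \<delta>" .
        then have "(\<Sum>(u, v)\<in>h ` B. norm (x v - x u)) < e / 2"
        proof (rule \<delta>[rotated 3])
          show "\<forall>(u, v)\<in>h ` B. u \<le> v \<and> {u..v} \<subseteq> {a..b}"
            using KI by (fastforce simp: B_def h_def)
          show "pairwise (\<lambda>(u, v) (c, d). {u<..<v} \<inter> {c<..<d} = {}) (h ` B)"
            unfolding pairwise_def using inter by (fastforce simp: h_def)
        qed (use finB in auto)
        moreover have "(\<Sum>(u, v)\<in>h ` B. norm (x v - x u)) = (\<Sum>p\<in>B. norm (F p))"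
          by (subst sumB) (auto simp: h_def F_def g'_def B_def norm_minus_commute intro!: sum.cong)
        ultimately show "(\<Sum>p\<in>{p\<in>D. fst p \<in> N}. norm (F p)) < e / 2" by (simp add: B_def)
      next
        have "norm (F p) \<le> e1 * measure lborel (snd p)" if "p \<in> D" "fst p \<notin> N" for p
        proof -
          obtain t K where p: "p = (t, K)" by fastforce
          then have tK: "(t, K) \<in> D" "t \<notin> N" using that by auto
          note K = KI[OF tK(1)]
          have t: "t \<in> {a..b} - N" using K tK by auto
          have "Inf K \<in> ball t (r t)" "Sup K \<in> ball t (r t)"
            using K by (metis atLeastAtMost_iff order_refl order_trans subsetD)+
          then have d: "\<bar>Inf K - t\<bar> < r t" "\<bar>Sup K - t\<bar> < r t"
            by (auto simp: dist_real_def)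
          have in_ab: "Inf K \<in> {a..b}" "Sup K \<in> {a..b}" using K by auto
          have b: "norm (x (Sup K) - x t - (Sup K - t) *\<^sub>R g t) \<le> e1 * \<bar>Sup K - t\<bar>"
            "norm (x (Inf K) - x t - (Inf K - t) *\<^sub>R g t) \<le> e1 * \<bar>Inf K - t\<bar>"
            using r(3)[OF t in_ab(2) d(2)] r(3)[OF t in_ab(1) d(1)] .
          have meas: "measure lborel K = Sup K - Inf K" using K by blast
          have "F p = (x (Inf K) - x t - (Inf K - t) *\<^sub>R g t) - (x (Sup K) - x t - (Sup K - t) *\<^sub>R g t)"
            using tK(2) by (simp add: F_def p g'_def meas scaleR_left_diff_distrib)
          also have "norm \<dots> \<le> e1 * \<bar>Inf K - t\<bar> + e1 * \<bar>Sup K - t\<bar>"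
            using b norm_triangle_ineq4 by (smt (verit))
          also have "\<dots> = e1 * measure lborel K"
            using K by (simp add: meas distrib_left[symmetric] del: distrib_left)
          finally show ?thesis by (simp add: p)
        qed
        then have "(\<Sum>p\<in>{p\<in>D. fst p \<notin> N}. norm (F p))
            \<le> (\<Sum>p\<in>{p\<in>D. fst p \<notin> N}. e1 * measure lborel (snd p))"
          by (intro sum_mono) auto
        also have "\<dots> \<le> (\<Sum>p\<in>D. e1 * measure lborel (snd p))"
          using \<open>e1 > 0\<close> by (intro sum_mono2) (auto simp: fin)
        also have "\<dots> = e1 * (b - a)"
          using additive_content_tagged_division[of D a b] D \<open>a \<le> b\<close>
          by (simp add: sum_distrib_left[symmetric] case_prod_unfold)
        also have "\<dots> \<le> e / 2"
          using \<open>e > 0\<close> \<open>a \<le> b\<close> by (simp add: e1_def field_simps)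
        finally show "(\<Sum>p\<in>{p\<in>D. fst p \<notin> N}. norm (F p)) \<le> e / 2" .
      qed
      finally show ?thesis by simp
    qed
    show "\<exists>\<gamma>. gauge \<gamma> \<and> (\<forall>\<D>. \<D> tagged_division_of {a..b} \<and> \<gamma> fine \<D> \<longrightarrow>
        norm ((\<Sum>(x, k)\<in>\<D>. measure lborel k *\<^sub>R g' x) - (x b - x a)) < e)"
      by (intro exI[of _ \<gamma>] conjI allI impI gauge) (elim conjE, rule main)
  qed
  then show ?thesis
    by (rule has_integral_spike[OF N, rotated]) (auto simp: g'_def)
qed

section \<open>Lebesgue differentiation of indefinite integrals\<close>

lemma integrable_AE_right_derivative:
  fixes g :: "real \<Rightarrow> 'a::euclidean_space"
  assumes "\<And>a b. g integrable_on {a..b}"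
  obtains N where "negligible N"
    "\<And>t e. t \<notin> N \<Longrightarrow> 0 < e \<Longrightarrow>
      \<exists>d>0. \<forall>h. 0 < h \<and> h < d \<longrightarrow> norm (integral {t..t + h} g - h *\<^sub>R g t) \<le> e * h"
proof -
  obtain N where N: "negligible N" "\<And>x e. \<lbrakk>x \<notin> N; 0 < e\<rbrakk> \<Longrightarrow>
      \<exists>d>0. \<forall>h. 0 < h \<and> h < d \<longrightarrow>
        norm (integral (cbox x (x + h *\<^sub>R One)) g /\<^sub>R h ^ DIM(real) - g x) < e"
    using integrable_ccontinuous_explicit[of g] assms by (auto simp: box_real)
  have "norm (integral {t..t + h} g - h *\<^sub>R g t) \<le> e * h"
    if "norm (integral {t..t + h} g /\<^sub>R h - g t) < e" "h > 0" for t h e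
  proof -
    have "integral {t..t + h} g - h *\<^sub>R g t = h *\<^sub>R (integral {t..t + h} g /\<^sub>R h - g t)"
      using \<open>h > 0\<close> by (simp add: algebra_simps)
    then have "norm (integral {t..t + h} g - h *\<^sub>R g t) = h * norm (integral {t..t + h} g /\<^sub>R h - g t)"
      using \<open>h > 0\<close> by simp
    also have "\<dots> \<le> e * h" using that by (simp add: mult.commute)
    finally show ?thesis .
  qed
  then show ?thesis using N by (intro that[of N]) (simp_all, meson)
qed

text \<open>The known averages run over intervals to the right of \<open>t\<close>. The left-hand
  quotient at \<open>t\<close> is the right-hand quotient at \<open>- t\<close> of the reflected
  function, so a second null set, reflected back, takes care of it.\<close>

lemma integrable_AE_vector_derivative:
  fixes g :: "real \<Rightarrow> 'a::euclidean_space"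
  assumes g: "\<And>a b. g integrable_on {a..b}"
  obtains N where "negligible N"
    "\<And>t a. t \<notin> N \<Longrightarrow> a < t \<Longrightarrow> ((\<lambda>u. integral {a..u} g) has_vector_derivative g t) (at t)"
proof -
  obtain N1 where N1: "negligible N1"
    "\<And>t e. t \<notin> N1 \<Longrightarrow> 0 < e \<Longrightarrow>
      \<exists>d>0. \<forall>h. 0 < h \<and> h < d \<longrightarrow> norm (integral {t..t + h} g - h *\<^sub>R g t) \<le> e * h"
    using integrable_AE_right_derivative[OF g] by blast
  have "(\<lambda>t. g (- t)) integrable_on {a..b}" for a b
    using Henstock_Kurzweil_Integration.integrable_reflect_real[of g "- a" "- b"] g[of "- b" "- a"] by simp
  then obtain N2 where N2: "negligible N2"
    "\<And>t e. t \<notin> N2 \<Longrightarrow> 0 < e \<Longrightarrow> \<exists>d>0. \<forall>h. 0 < h \<and> h < d \<longrightarrow>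
      norm (integral {t..t + h} (\<lambda>t. g (- t)) - h *\<^sub>R g (- t)) \<le> e * h"
    using integrable_AE_right_derivative[of "\<lambda>t. g (- t)"] by blast
  have "negligible (uminus ` N2)"
    by (rule negligible_differentiable_image_negligible) (auto intro!: N2 derivative_intros)
  then have "negligible (N1 \<union> uminus ` N2)" using N1 by simp
  moreover have "((\<lambda>u. integral {a..u} g) has_vector_derivative g t) (at t)"
    if t: "t \<notin> N1 \<union> uminus ` N2" "a < t" for t a
    unfolding has_vector_derivative_def has_derivative_at_alt
  proof (intro conjI allI impI)
    fix e :: real assume "e > 0"
    have "t \<notin> N1" "- t \<notin> N2" using t(1) by force+
    obtain d1 where d1: "d1 > 0"
      "\<And>h. 0 < h \<Longrightarrow> h < d1 \<Longrightarrow> norm (integral {t..t + h} g - h *\<^sub>R g t) \<le> e * h"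
      using N1(2)[OF \<open>t \<notin> N1\<close> \<open>e > 0\<close>] by blast
    obtain d2 where d2: "d2 > 0"
      "\<And>h. 0 < h \<Longrightarrow> h < d2 \<Longrightarrow> norm (integral {- t..- t + h} (\<lambda>t. g (- t)) - h *\<^sub>R g (- (- t))) \<le> e * h"
      using N2(2)[OF \<open>- t \<notin> N2\<close> \<open>e > 0\<close>] by blast
    show "\<exists>d>0. \<forall>y. norm (y - t) < d \<longrightarrow>
        norm (integral {a..y} g - integral {a..t} g - (y - t) *\<^sub>R g t) \<le> e * norm (y - t)"
    proof (intro exI conjI allI impI)
      show "min (min d1 d2) (t - a) > 0" using d1 d2 t by simp
      fix y assume y: "norm (y - t) < min (min d1 d2) (t - a)"
      then have "a < y" by auto
      consider "y = t" | "y > t" | "y < t" by linarith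
      then show "norm (integral {a..y} g - integral {a..t} g - (y - t) *\<^sub>R g t) \<le> e * norm (y - t)"
      proof cases
        case 1 then show ?thesis by simp
      next
        case 2
        have "integral {a..y} g = integral {a..t} g + integral {t..y} g"
          using Henstock_Kurzweil_Integration.integral_combine[of a t y g] g 2 t by simp
        then show ?thesis using d1(2)[of "y - t"] y 2 by simp
      next
        case 3
        have eq: "integral {a..t} g = integral {a..y} g + integral {y..t} g"
          using Henstock_Kurzweil_Integration.integral_combine[of a y t g] g 3 \<open>a < y\<close> by simp
        have "integral {- t..- y} (\<lambda>t. g (- t)) = integral {y..t} g"
          by (rule Henstock_Kurzweil_Integration.integral_reflect_real)
        then have "norm (integral {y..t} g - (t - y) *\<^sub>R g t) \<le> e * (t - y)"
          using d2(2)[of "t - y"] y 3 by simp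
        moreover have "integral {a..y} g - integral {a..t} g - (y - t) *\<^sub>R g t
            = - (integral {y..t} g - (t - y) *\<^sub>R g t)"
          by (simp add: eq algebra_simps)
        ultimately show ?thesis using 3 by (simp only: norm_minus_cancel) simp
      qed
    qed
  qed (rule bounded_linear_scaleR_left)
  ultimately show ?thesis by (rule that)
qed

section \<open>Closure properties of absolute continuity and a mean value inequality\<close>

text \<open>A common source for sums, linear images, squares and Lipschitz functions: two dominating
  functions are what a sum needs, and the other cases use the same one twice.\<close>

lemma abs_continuous_on_dominated:
  assumes x: "abs_continuous_on S x" and y: "abs_continuous_on S y" and "K \<ge> 0"
    and le: "\<And>a b. a \<le> b \<Longrightarrow> {a..b} \<subseteq> S \<Longrightarrow>
      norm (z b - z a) \<le> K * (norm (x b - x a) + norm (y b - y a))"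
  shows "abs_continuous_on S z"
  unfolding abs_continuous_on_def
proof (intro allI impI)
  fix \<epsilon> :: real assume "\<epsilon> > 0"
  \<comment> \<open>With \<open>K + 1\<close> in place of \<open>K\<close> the final bound is K (2
    e) = \<open>\<epsilon>\<close> - 2 e, which is strict and also covers
    \<open>K = 0\<close>.\<close>
  define e where "e = \<epsilon> / (2 * (K + 1))"
  have "e > 0" using \<open>\<epsilon> > 0\<close> \<open>K \<ge> 0\<close> by (simp add: e_def)
  from x[unfolded abs_continuous_on_def, THEN spec, THEN mp, OF this] obtain d1 where "d1 > 0" and
    d1: "\<forall>D. finite D \<longrightarrow> (\<forall>(u, v)\<in>D. u \<le> v \<and> {u..v} \<subseteq> S) \<longrightarrow>
      pairwise (\<lambda>(u, v) (c, d). {u<..<v} \<inter> {c<..<d} = {}) D \<longrightarrow>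
      (\<Sum>(u, v)\<in>D. v - u) < d1 \<longrightarrow> (\<Sum>(u, v)\<in>D. norm (x v - x u)) < e"
    by (elim exE conjE)
  from y[unfolded abs_continuous_on_def, THEN spec, THEN mp, OF \<open>e > 0\<close>] obtain d2 where "d2 > 0" and
    d2: "\<forall>D. finite D \<longrightarrow> (\<forall>(u, v)\<in>D. u \<le> v \<and> {u..v} \<subseteq> S) \<longrightarrow>
      pairwise (\<lambda>(u, v) (c, d). {u<..<v} \<inter> {c<..<d} = {}) D \<longrightarrow>
      (\<Sum>(u, v)\<in>D. v - u) < d2 \<longrightarrow> (\<Sum>(u, v)\<in>D. norm (y v - y u)) < e"
    by (elim exE conjE)
  show "\<exists>\<delta>>0. \<forall>D. finite D \<longrightarrow> (\<forall>(u, v)\<in>D. u \<le> v \<and> {u..v} \<subseteq> S) \<longrightarrow>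
      pairwise (\<lambda>(u, v) (c, d). {u<..<v} \<inter> {c<..<d} = {}) D \<longrightarrow>
      (\<Sum>(u, v)\<in>D. v - u) < \<delta> \<longrightarrow> (\<Sum>(u, v)\<in>D. norm (z v - z u)) < \<epsilon>"
  proof (intro exI[of _ "min d1 d2"] conjI allI impI)
    fix D
    assume D: "finite D" "\<forall>(u, v)\<in>D. u \<le> v \<and> {u..v} \<subseteq> S"
      "pairwise (\<lambda>(u, v) (c, d). {u<..<v} \<inter> {c<..<d} = {}) D" "(\<Sum>(u, v)\<in>D. v - u) < min d1 d2"
    have d: "(\<Sum>(u, v)\<in>D. v - u) < d1" "(\<Sum>(u, v)\<in>D. v - u) < d2" using D(4) by auto
    have X: "(\<Sum>(u, v)\<in>D. norm (x v - x u)) < e"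
      by (rule d1[THEN spec, THEN mp, THEN mp, THEN mp, THEN mp]) (rule D d)+
    have Y: "(\<Sum>(u, v)\<in>D. norm (y v - y u)) < e"
      by (rule d2[THEN spec, THEN mp, THEN mp, THEN mp, THEN mp]) (rule D d)+
    have "(\<Sum>(u, v)\<in>D. norm (z v - z u)) \<le> (\<Sum>(u, v)\<in>D. K * (norm (x v - x u) + norm (y v - y u)))"
      using D(2) le by (intro sum_mono) auto
    also have "\<dots> = K * ((\<Sum>(u, v)\<in>D. norm (x v - x u)) + (\<Sum>(u, v)\<in>D. norm (y v - y u)))"
      by (simp add: case_prod_unfold sum_distrib_left sum.distrib distrib_left)
    also have "\<dots> \<le> K * (e + e)"
      by (intro mult_left_mono \<open>K \<ge> 0\<close> add_mono less_imp_le X Y)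
    also have "\<dots> = (K + 1) * (2 * e) - 2 * e" by (simp add: algebra_simps)
    also have "(K + 1) * (2 * e) = \<epsilon>" using \<open>K \<ge> 0\<close> by (simp add: e_def field_simps)
    also have "\<epsilon> - 2 * e < \<epsilon>" using \<open>e > 0\<close> by simp
    finally show "(\<Sum>(u, v)\<in>D. norm (z v - z u)) < \<epsilon>" .
  qed (use \<open>d1 > 0\<close> \<open>d2 > 0\<close> in auto)
qed

lemma abs_continuous_on_lipschitz:
  assumes "K \<ge> 0" "\<And>a b. a \<le> b \<Longrightarrow> {a..b} \<subseteq> S \<Longrightarrow> norm (z b - z a) \<le> K * (b - a)"
  shows "abs_continuous_on S z"
proof -
  have id: "abs_continuous_on S (\<lambda>t::real. t)"
    unfolding abs_continuous_on_def
  proof (intro allI impI)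
    fix \<epsilon> :: real assume "\<epsilon> > 0"
    have "(\<Sum>(a, b)\<in>D. norm (b - a)) = (\<Sum>(a, b)\<in>D. b - a)"
      if "\<forall>(a, b)\<in>D. a \<le> b \<and> {a..b} \<subseteq> S" for D :: "(real \<times> real) set"
      using that by (intro sum.cong) auto
    then show "\<exists>\<delta>>0. \<forall>D. finite D \<longrightarrow> (\<forall>(a, b)\<in>D. a \<le> b \<and> {a..b} \<subseteq> S) \<longrightarrow>
        pairwise (\<lambda>(a, b) (c, d). {a<..<b} \<inter> {c<..<d} = {}) D \<longrightarrow>
        (\<Sum>(a, b)\<in>D. b - a) < \<delta> \<longrightarrow> (\<Sum>(a, b)\<in>D. norm (b - a)) < \<epsilon>"
      by (intro exI[of _ \<epsilon>]) (simp add: \<open>\<epsilon> > 0\<close>)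
  qed
  show ?thesis
  proof (rule abs_continuous_on_dominated[OF id id \<open>K \<ge> 0\<close>])
    fix a b :: real assume ab: "a \<le> b" "{a..b} \<subseteq> S"
    have "norm (z b - z a) \<le> K * (b - a)" by (rule assms(2)[OF ab])
    also have "\<dots> \<le> K * (norm (b - a) + norm (b - a))"
      using ab \<open>K \<ge> 0\<close> by (intro mult_left_mono) auto
    finally show "norm (z b - z a) \<le> K * (norm (b - a) + norm (b - a))" .
  qed
qed

lemma abs_continuous_on_add:
  assumes "abs_continuous_on S x" "abs_continuous_on S y"
  shows "abs_continuous_on S (\<lambda>t. x t + y t)"
  by (rule abs_continuous_on_dominated[OF assms, of 1]) (auto intro: norm_diff_triangle_ineq)

lemma abs_continuous_on_compose_bounded_linear:
  assumes "bounded_linear f" "abs_continuous_on S x"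
  shows "abs_continuous_on S (\<lambda>t. f (x t))"
proof -
  interpret bounded_linear f by fact
  obtain K where K: "K > 0" "\<And>v. norm (f v) \<le> norm v * K" using pos_bounded by blast
  have "norm (f (x b) - f (x a)) \<le> K * (norm (x b - x a) + norm (x b - x a))" for a b
  proof -
    have "norm (f (x b) - f (x a)) \<le> K * norm (x b - x a)"
      using K(2)[of "x b - x a"] by (simp add: diff mult.commute)
    also have "\<dots> \<le> K * (norm (x b - x a) + norm (x b - x a))"
      using K(1) by (intro mult_left_mono) auto
    finally show ?thesis .
  qed
  then show ?thesis
    using K(1) by (intro abs_continuous_on_dominated[OF assms(2) assms(2), of K]) auto
qed

lemma abs_continuous_on_power2:
  fixes x :: "real \<Rightarrow> real"
  assumes x: "abs_continuous_on S x" and bnd: "\<And>t. t \<in> S \<Longrightarrow> \<bar>x t\<bar> \<le> B"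
  shows "abs_continuous_on S (\<lambda>t. (x t)\<^sup>2)"
proof (rule abs_continuous_on_dominated[OF x x, of "\<bar>B\<bar>"])
  fix a b :: real assume ab: "a \<le> b" "{a..b} \<subseteq> S"
  have ends: "a \<in> S" "b \<in> S" using ab by auto
  have "norm ((x b)\<^sup>2 - (x a)\<^sup>2) = \<bar>x b + x a\<bar> * \<bar>x b - x a\<bar>"
    by (simp add: power2_eq_square abs_mult[symmetric] algebra_simps)
  also have "\<dots> \<le> (\<bar>B\<bar> + \<bar>B\<bar>) * \<bar>x b - x a\<bar>"
    using bnd[OF ends(1)] bnd[OF ends(2)] by (intro mult_right_mono) auto
  finally show "norm ((x b)\<^sup>2 - (x a)\<^sup>2) \<le> \<bar>B\<bar> * (norm (x b - x a) + norm (x b - x a))"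
    by (simp add: algebra_simps)
qed simp

text \<open>The substitute for the mean value theorem along trajectories: it turns an almost
  everywhere bound on a derivative into a bound on an increment. It is applied to the square of xi
  and to the Lyapunov function.\<close>

lemma abs_continuous_on_derivative_le:
  fixes v :: "real \<Rightarrow> real"
  assumes "a \<le> b" "abs_continuous_on {a..b} v" and N: "negligible N"
    and deriv: "\<And>t. t \<in> {a..b} - N \<Longrightarrow>
      \<exists>D\<le>k. (v has_vector_derivative D) (at t within {a..b})"
  shows "v b - v a \<le> k * (b - a)"
proof -
  obtain g where g: "\<And>t. t \<in> {a..b} - N \<Longrightarrow> g t \<le> k \<and> (v has_vector_derivative g t) (at t within {a..b})"
    using deriv by metis
  \<comment> \<open>The value \<open>k\<close> on the exceptional set makes the comparison of
    integrands hold at every point.\<close>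
  define G where "G t = (if t \<in> {a..b} - N then g t else k)" for t
  have "(G has_integral (v b - v a)) {a..b}"
    by (rule abs_continuous_on_has_integral[OF assms(1-3)]) (use g in \<open>auto simp: G_def\<close>)
  moreover have "((\<lambda>_. k) has_integral k * (b - a)) {a..b}"
    using has_integral_const_real[of k a b] \<open>a \<le> b\<close> by (simp add: mult.commute)
  ultimately show ?thesis
    by (rule has_integral_le) (use g in \<open>auto simp: G_def\<close>)
qed

lemma abs_continuous_on_imp_continuous_on:
  assumes "abs_continuous_on {a..b} x"
  shows "continuous_on {a..b} x"
  unfolding continuous_on_iff
proof (intro ballI allI impI)
  fix t e :: real assume t: "t \<in> {a..b}" and "e > 0"
  from assms[unfolded abs_continuous_on_def, THEN spec, THEN mp, OF \<open>e > 0\<close>] obtain d where "d > 0" and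
    d: "\<forall>D. finite D \<longrightarrow> (\<forall>(u, v)\<in>D. u \<le> v \<and> {u..v} \<subseteq> {a..b}) \<longrightarrow>
      pairwise (\<lambda>(u, v) (c, d). {u<..<v} \<inter> {c<..<d} = {}) D \<longrightarrow>
      (\<Sum>(u, v)\<in>D. v - u) < d \<longrightarrow> (\<Sum>(u, v)\<in>D. norm (x v - x u)) < e"
    by (elim exE conjE)
  have "norm (x v - x u) < e" if "u \<le> v" "{u..v} \<subseteq> {a..b}" "v - u < d" for u v
    using d[THEN spec, of "{(u, v)}"] that by (simp add: pairwise_def)
  then have *: "dist (x u) (x v) < e" if "u \<le> v" "{u..v} \<subseteq> {a..b}" "v - u < d" for u v
    using that by (simp add: dist_norm norm_minus_commute)
  have "dist (x s) (x t) < e" if "s \<in> {a..b}" "dist s t < d" for s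
    using *[of s t] *[of t s] that t
    by (cases "s \<le> t") (auto simp: dist_commute dist_real_def)
  then show "\<exists>d>0. \<forall>s\<in>{a..b}. dist s t < d \<longrightarrow> dist (x s) (x t) < e" using \<open>d > 0\<close> by blast
qed

lemma abs_continuous_on_bounded:
  assumes "abs_continuous_on {a..b} x"
  obtains B where "\<And>t. t \<in> {a..b} \<Longrightarrow> norm (x t) \<le> B"
proof -
  have "compact (x ` {a..b})"
    by (intro compact_continuous_image abs_continuous_on_imp_continuous_on assms) simp
  then show ?thesis using that compact_imp_bounded bounded_iff by (metis imageI)
qed

section \<open>Global existence of Caratheodory solutions\<close>

text \<open>One null set serves all subintervals at once, because a derivative within
  \<open>J\<close> restricts to each of them.\<close>

lemma caratheodory_solution_null_set:
  assumes "caratheodory_solution f J x"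
  obtains N where "negligible N"
    "\<And>t a b. t \<in> {a..b} - N \<Longrightarrow> {a..b} \<subseteq> J \<Longrightarrow> (x has_vector_derivative f t (x t)) (at t within {a..b})"
proof -
  have "AE t in lebesgue. t \<in> J \<longrightarrow> (x has_vector_derivative f t (x t)) (at t within J)"
    using assms unfolding caratheodory_solution_def by blast
  then obtain N where "N \<in> null_sets lebesgue" and
    N: "\<And>t. t \<notin> N \<Longrightarrow> t \<in> J \<Longrightarrow> (x has_vector_derivative f t (x t)) (at t within J)"
    by (rule AE_E3) auto
  show ?thesis
  proof (rule that)
    show "negligible N" using \<open>N \<in> null_sets lebesgue\<close> by (simp add: negligible_iff_null_sets)
    fix t a b assume "t \<in> {a..b} - N" "{a..b} \<subseteq> J"
    then have "(x has_vector_derivative f t (x t)) (at t within J)" using N by blast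
    then show "(x has_vector_derivative f t (x t)) (at t within {a..b})"
      using \<open>{a..b} \<subseteq> J\<close> has_vector_derivative_within_subset by blast
  qed
qed

text \<open>The constants are uniform in time, and only times \<open>t \<ge> 0\<close> are
  constrained because solutions start at \<open>\<tau> \<ge> 0\<close>. Measurability is required
  directly of the composites \<open>f t (\<phi> t)\<close>, the form in which Picard iteration uses
  it.\<close>

locale caratheodory_field =
  fixes f :: "real \<Rightarrow> 'a::euclidean_space \<Rightarrow> 'a" and A B :: real
  assumes A_pos: "A > 0" and B_pos: "B > 0"
    and growth: "t \<ge> 0 \<Longrightarrow> norm (f t x) \<le> A + B * norm x"
    and locally_lipschitz: "\<exists>L\<ge>0. \<forall>t\<ge>0. \<forall>x\<in>cball 0 R. \<forall>y\<in>cball 0 R. norm (f t x - f t y) \<le> L * norm (x - y)"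
    and superposition_measurable: "\<phi> \<in> borel_measurable (lebesgue_on {0..}) \<Longrightarrow>
      (\<lambda>t. f t (\<phi> t)) \<in> borel_measurable (lebesgue_on {0..})"
begin

text \<open>Integral equations restrict and glue without any care for derivatives at junction
  points. Continuity is not demanded, since it follows from that of indefinite integrals.\<close>

definition integral_solution :: "real \<Rightarrow> real set \<Rightarrow> (real \<Rightarrow> 'a) \<Rightarrow> bool" where
  "integral_solution \<tau> J x \<longleftrightarrow> (\<forall>t\<in>J. ((\<lambda>r. f r (x r)) has_integral (x t - x \<tau>)) {\<tau>..t})"

lemma integral_solutionD:
  "integral_solution \<tau> J x \<Longrightarrow> t \<in> J \<Longrightarrow> ((\<lambda>r. f r (x r)) has_integral (x t - x \<tau>)) {\<tau>..t}"
  by (simp add: integral_solution_def)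

lemma integral_solution_increment:
  assumes x: "integral_solution \<tau> J x" and "v \<in> J" "u \<in> J" "\<tau> \<le> u" "u \<le> v"
  shows "((\<lambda>r. f r (x r)) has_integral (x v - x u)) {u..v}"
proof -
  have int: "(\<lambda>r. f r (x r)) integrable_on {\<tau>..v}"
    using integral_solutionD[OF x \<open>v \<in> J\<close>] by blast
  have "integral {\<tau>..u} (\<lambda>r. f r (x r)) + integral {u..v} (\<lambda>r. f r (x r)) = integral {\<tau>..v} (\<lambda>r. f r (x r))"
    by (rule Henstock_Kurzweil_Integration.integral_combine) (use assms int in auto)
  then have "integral {u..v} (\<lambda>r. f r (x r)) = x v - x u"
    using integral_solutionD[OF x, THEN integral_unique] assms by (simp add: algebra_simps)
  moreover have "(\<lambda>r. f r (x r)) integrable_on {u..v}"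
    using integrable_on_subinterval[OF int] assms by simp
  ultimately show ?thesis using integrable_integral by fastforce
qed

lemma integral_solution_bound:
  assumes x: "integral_solution \<tau> J x" and "v \<in> J" "u \<in> J" "0 \<le> \<tau>" "\<tau> \<le> u" "u \<le> v"
    and m: "\<And>r. r \<in> {u..v} \<Longrightarrow> norm (x r) \<le> m"
  shows "norm (x v - x u) \<le> (A + B * m) * (v - u)"
proof -
  have "norm (integral {u..v} (\<lambda>r. f r (x r))) \<le> integral {u..v} (\<lambda>_. A + B * m)"
  proof (rule Henstock_Kurzweil_Integration.integral_norm_bound_integral)
    fix r assume r: "r \<in> {u..v}"
    have "norm (f r (x r)) \<le> A + B * norm (x r)" using growth[of r] r assms by auto
    also have "\<dots> \<le> A + B * m" using m[OF r] B_pos by simp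
    finally show "norm (f r (x r)) \<le> A + B * m" .
  qed (use integral_solution_increment[OF assms(1,2,3,5,6)] in auto)
  then show ?thesis
    using integral_unique[OF integral_solution_increment[OF assms(1,2,3,5,6)]] \<open>u \<le> v\<close>
    by (simp add: mult.commute)
qed

lemma integral_solution_continuous_on:
  assumes x: "integral_solution \<tau> J x" and "b \<in> J" "{\<tau>..b} \<subseteq> J"
  shows "continuous_on {\<tau>..b} x"
proof -
  have "continuous_on {\<tau>..b} (\<lambda>t. x \<tau> + integral {\<tau>..t} (\<lambda>r. f r (x r)))"
    using integral_solutionD[OF x \<open>b \<in> J\<close>]
    by (intro continuous_intros indefinite_integral_continuous_1) blast
  then show ?thesis
    by (rule continuous_on_eq) (use integral_solutionD[OF x, THEN integral_unique] assms in auto)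
qed

lemma caratheodory_solution_has_integral:
  assumes x: "caratheodory_solution f J x" and "{a..b} \<subseteq> J" "a \<le> b"
  shows "((\<lambda>r. f r (x r)) has_integral (x b - x a)) {a..b}"
proof -
  obtain N where N: "negligible N" "\<And>t a b. t \<in> {a..b} - N \<Longrightarrow> {a..b} \<subseteq> J \<Longrightarrow>
      (x has_vector_derivative f t (x t)) (at t within {a..b})"
    using caratheodory_solution_null_set[OF x] by blast
  show ?thesis
  proof (rule abs_continuous_on_has_integral[OF \<open>a \<le> b\<close> _ N(1)])
    show "abs_continuous_on {a..b} x" using x assms unfolding caratheodory_solution_def by blast
  qed (rule N(2)[OF _ \<open>{a..b} \<subseteq> J\<close>])
qed

text \<open>On a compact interval the trajectory is bounded, hence so is the field along it; this
  gives a Lipschitz bound and with it absolute continuity. The derivative comes from Lebesgue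
  differentiation.\<close>

lemma integral_solution_imp_caratheodory_solution:
  assumes "0 \<le> \<tau>" and x: "integral_solution \<tau> {\<tau>..} x"
  shows "caratheodory_solution f {\<tau>..} x"
  unfolding caratheodory_solution_def
proof (intro conjI allI impI)
  show "is_interval {\<tau>..}" by (rule is_interval_ci)
next
  fix a b assume ab: "{a..b} \<subseteq> {\<tau>..}"
  have "compact (x ` {\<tau>..max \<tau> b})"
    by (intro compact_continuous_image integral_solution_continuous_on[OF x]) auto
  then obtain m where m: "\<And>r. r \<in> {\<tau>..max \<tau> b} \<Longrightarrow> norm (x r) \<le> m"
    using compact_imp_bounded bounded_iff by (metis imageI)
  show "abs_continuous_on {a..b} x"
  proof (rule abs_continuous_on_lipschitz[of "A + B * \<bar>m\<bar>"])
    fix u v assume uv: "u \<le> v" "{u..v} \<subseteq> {a..b}"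
    then have "{u..v} \<subseteq> {\<tau>..max \<tau> b}" "u \<in> {\<tau>..}" "v \<in> {\<tau>..}" using ab by auto
    moreover from this have "norm (x r) \<le> \<bar>m\<bar>" if "r \<in> {u..v}" for r
      using m[of r] that by (meson abs_ge_self order_trans subsetD)
    ultimately show "norm (x v - x u) \<le> (A + B * \<bar>m\<bar>) * (v - u)"
      using uv \<open>0 \<le> \<tau>\<close> by (intro integral_solution_bound[OF x]) auto
  qed (use A_pos B_pos in simp)
next
  \<comment> \<open>Extension by 0 makes \<open>g\<close> integrable on every compact interval, as
    the differentiation theorem requires.\<close>
  define g where "g r = (if r \<in> {\<tau>..} then f r (x r) else 0)" for r
  have g_int: "g integrable_on {a..b}" for a b
  proof -
    have "(\<lambda>r. f r (x r)) integrable_on {\<tau>..max \<tau> b}"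
      using integral_solutionD[OF x, of "max \<tau> b"] by auto
    then have "(\<lambda>r. f r (x r)) integrable_on {max \<tau> a..b}"
      by (rule integrable_on_subinterval) auto
    moreover have "{\<tau>..} \<inter> {a..b} = {max \<tau> a..b}" by auto
    ultimately show ?thesis
      unfolding g_def[abs_def] integrable_restrict_Int by simp
  qed
  obtain N where N: "negligible N"
    "\<And>t a. t \<notin> N \<Longrightarrow> a < t \<Longrightarrow> ((\<lambda>u. integral {a..u} g) has_vector_derivative g t) (at t)"
    by (rule integrable_AE_vector_derivative[OF g_int]) (rule that)
  have eq: "x t = x \<tau> + integral {\<tau>..t} g" if "\<tau> \<le> t" for t
  proof -
    have "integral {\<tau>..t} g = integral {\<tau>..t} (\<lambda>r. f r (x r))"
      by (rule integral_cong) (auto simp: g_def)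
    then show ?thesis using integral_solutionD[OF x, of t, THEN integral_unique] that by simp
  qed
  \<comment> \<open>The point \<open>\<tau>\<close> joins the null set because the indefinite
    integral is differentiated only strictly to the right of its base point.\<close>
  have "(x has_vector_derivative f t (x t)) (at t within {\<tau>..})" if "t \<notin> insert \<tau> N" "t \<in> {\<tau>..}" for t
  proof -
    have t: "t \<notin> N" "\<tau> < t" using that by auto
    have "((\<lambda>u. x \<tau> + integral {\<tau>..u} g) has_vector_derivative g t) (at t)"
      using N(2)[OF t] by (auto intro!: derivative_eq_intros)
    then have "((\<lambda>u. x \<tau> + integral {\<tau>..u} g) has_vector_derivative g t) (at t within {\<tau>..})"
      by (rule has_vector_derivative_at_within)
    then have "(x has_vector_derivative g t) (at t within {\<tau>..})"
      by (rule has_vector_derivative_transform_within[OF _ zero_less_one \<open>t \<in> {\<tau>..}\<close>]) (rule eq[symmetric], simp)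
    then show ?thesis using t by (simp add: g_def)
  qed
  moreover have "insert \<tau> N \<in> null_sets lebesgue" using N(1) negligible_iff_null_sets by auto
  ultimately show "AE t in lebesgue. t \<in> {\<tau>..} \<longrightarrow> (x has_vector_derivative f t (x t)) (at t within {\<tau>..})"
    by (intro AE_I'[of "insert \<tau> N"]) blast+
qed

lemma superposition_integrable:
  assumes \<phi>: "\<phi> \<in> borel_measurable (lebesgue_on {0..})" and "0 \<le> a"
    and bnd: "\<And>r. r \<in> {a..b} \<Longrightarrow> norm (f r (\<phi> r)) \<le> G"
  shows "(\<lambda>r. f r (\<phi> r)) integrable_on {a..b}"
proof (rule measurable_bounded_by_integrable_imp_integrable)
  show "(\<lambda>r. f r (\<phi> r)) \<in> borel_measurable (lebesgue_on {a..b})"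
    by (rule measurable_restrict_mono[OF superposition_measurable[OF \<phi>]]) (use \<open>0 \<le> a\<close> in auto)
  show "(\<lambda>_. G) integrable_on {a..b}" by (rule integrable_const_ivl)
qed (use bnd in auto)

text \<open>In a ball of radius R >= 1 the speed is at most (A + B) R, so during a time
  \<open>step\<close> the displacement is at most R / 2, whatever R is.\<close>

definition step :: real where "step = 1 / (2 * (A + B))"

lemma step_pos: "step > 0" and step_A: "step * A \<le> 1 / 2" and step_B: "step * B \<le> 1 / 2"
  and step_AB: "step * (A + B) = 1 / 2"
  using A_pos B_pos by (auto simp: step_def field_simps)

text \<open>Truncation to a large ball makes the field globally Lipschitz and bounded; the Picard operator is
  then a contraction for the sup norm weighted by \<open>exp (- K (t - s))\<close>. The length \<^const>\<open>step\<close> is short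
  enough that the solution never reaches the boundary of the ball.\<close>

lemma local_existence:
  assumes "0 \<le> s"
  shows "\<exists>x. x s = x0 \<and> integral_solution s {s..s + step} x"
proof -
  \<comment> \<open>With this radius the initial norm plus the displacement R / 2 equals R - 1 / 2,
    so the trajectory stays inside the ball.\<close>
  define R where "R = 2 * norm x0 + 1"
  have "R \<ge> 1" by (simp add: R_def)
  obtain L where "L \<ge> 0" and L: "\<And>t x y. t \<ge> 0 \<Longrightarrow> x \<in> cball 0 R \<Longrightarrow> y \<in> cball 0 R \<Longrightarrow>
      norm (f t x - f t y) \<le> L * norm (x - y)"
    using locally_lipschitz[of R] by blast
  define P where "P = closest_point (cball (0::'a) R)"
  have cb: "convex (cball (0::'a) R)" "closed (cball (0::'a) R)" "cball (0::'a) R \<noteq> {}"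
    using \<open>R \<ge> 1\<close> by auto
  have P_in: "P x \<in> cball 0 R" for x unfolding P_def by (rule closest_point_in_set[OF cb(2,3)])
  have P_self: "P x = x" if "norm x \<le> R" for x unfolding P_def using that by (intro closest_point_self) simp
  have P_lip: "norm (P x - P y) \<le> norm (x - y)" for x y
    using closest_point_lipschitz[OF cb, of x y] by (simp add: P_def dist_norm)
  have P_cont: "continuous_on UNIV P" unfolding P_def by (rule continuous_on_closest_point[OF cb])
  define G where "G = A + B * R"
  define K where "K = 2 * L + 1"
  have "K > 0" using \<open>L \<ge> 0\<close> by (simp add: K_def)
  define b where "b = s + step"
  have "s \<le> b" using step_pos by (simp add: b_def)
  \<comment> \<open>Here \<open>\<phi>\<close> is the trajectory with the weight divided out, so the
    weighted norm becomes the ordinary distance of bounded continuous functions. The choice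
    \<open>K = 2 * L + 1\<close> makes the contraction factor L / K at most 1 / 2.\<close>
  define w where "w \<phi> r = exp (K * (r - s)) *\<^sub>R apply_bcontfun \<phi> r" for \<phi> :: "real \<Rightarrow>\<^sub>C 'a" and r
  have G: "norm (f r (P y)) \<le> G" if "r \<ge> s" for r y
  proof -
    have "norm (f r (P y)) \<le> A + B * norm (P y)" using growth that \<open>0 \<le> s\<close> by simp
    also have "\<dots> \<le> A + B * R" using P_in[of y] B_pos by simp
    finally show ?thesis by (simp add: G_def)
  qed
  have lip: "norm (f r (P y) - f r (P z)) \<le> L * norm (y - z)" if "r \<ge> s" for r y z
  proof -
    have "norm (f r (P y) - f r (P z)) \<le> L * norm (P y - P z)" using L P_in that \<open>0 \<le> s\<close> by simp
    also have "\<dots> \<le> L * norm (y - z)" by (intro mult_left_mono P_lip \<open>L \<ge> 0\<close>)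
    finally show ?thesis .
  qed
  have int: "(\<lambda>r. f r (P (w \<phi> r))) integrable_on {s..t}" for \<phi> t
  proof (rule superposition_integrable[OF _ \<open>0 \<le> s\<close> G])
    have "continuous_on UNIV (\<lambda>r. P (w \<phi> r))"
      unfolding w_def by (intro continuous_on_compose2[OF P_cont] continuous_intros) auto
    then show "(\<lambda>r. P (w \<phi> r)) \<in> borel_measurable (lebesgue_on {0..})"
      by (intro continuous_imp_measurable_on_sets_lebesgue) (auto intro: continuous_on_subset)
  qed auto
  define T where "T \<phi> t = exp (- K * (t - s)) *\<^sub>R (x0 + integral {s..t} (\<lambda>r. f r (P (w \<phi> r))))"
    for \<phi> t
  have "continuous_on (cbox s b) (T \<phi>)" for \<phi>
    unfolding T_def box_real by (intro continuous_intros indefinite_integral_continuous_1 int)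
  \<comment> \<open>Freezing the values at the end points of [s, b] gives a bounded continuous
    function on the whole line, an element of a complete space.\<close>
  then have "\<exists>g :: real \<Rightarrow>\<^sub>C 'a. \<forall>t. g t = T \<phi> (clamp s b t)" for \<phi>
    using continuous_on_cbox_bcontfunE by metis
  then obtain \<Phi> where \<Phi>: "\<And>\<phi> t. apply_bcontfun (\<Phi> \<phi>) t = T \<phi> (clamp s b t)" by metis
  have "dist (\<Phi> \<phi>) (\<Phi> \<psi>) \<le> 1/2 * dist \<phi> \<psi>" for \<phi> \<psi>
  proof (rule dist_bound)
    fix u
    define t where "t = clamp s b u"
    have "t \<in> {s..b}" using clamp_in_interval[of s b u] \<open>s \<le> b\<close> by (simp add: t_def)
    let ?D = "integral {s..t} (\<lambda>r. f r (P (w \<phi> r))) - integral {s..t} (\<lambda>r. f r (P (w \<psi> r)))"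
    have expint: "((\<lambda>r. L * dist \<phi> \<psi> * exp (K * (r - s))) has_integral
        L * dist \<phi> \<psi> / K * exp (K * (t - s)) - L * dist \<phi> \<psi> / K * exp (K * (s - s))) {s..t}"
      using \<open>K > 0\<close> \<open>t \<in> {s..b}\<close>
      by (intro fundamental_theorem_of_calculus)
        (auto intro!: derivative_eq_intros simp flip: has_real_derivative_iff_has_vector_derivative)
    have "?D = integral {s..t} (\<lambda>r. f r (P (w \<phi> r)) - f r (P (w \<psi> r)))"
      by (rule Henstock_Kurzweil_Integration.integral_diff[symmetric]) (rule int)+
    then have "norm ?D = norm (integral {s..t} (\<lambda>r. f r (P (w \<phi> r)) - f r (P (w \<psi> r))))" by simp
    also have "\<dots> \<le> integral {s..t} (\<lambda>r. L * dist \<phi> \<psi> * exp (K * (r - s)))"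
    proof (rule Henstock_Kurzweil_Integration.integral_norm_bound_integral)
      show "(\<lambda>r. f r (P (w \<phi> r)) - f r (P (w \<psi> r))) integrable_on {s..t}"
        by (intro Henstock_Kurzweil_Integration.integrable_diff int)
      show "(\<lambda>r. L * dist \<phi> \<psi> * exp (K * (r - s))) integrable_on {s..t}" using expint by blast
      fix r assume "r \<in> {s..t}"
      then have "norm (f r (P (w \<phi> r)) - f r (P (w \<psi> r))) \<le> L * norm (w \<phi> r - w \<psi> r)"
        by (intro lip) simp
      also have "w \<phi> r - w \<psi> r = exp (K * (r - s)) *\<^sub>R (\<phi> r - \<psi> r)"
        by (simp add: w_def scaleR_diff_right)
      also have "L * norm \<dots> = L * (exp (K * (r - s)) * dist (\<phi> r) (\<psi> r))" by (simp add: dist_norm)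
      also have "\<dots> \<le> L * (exp (K * (r - s)) * dist \<phi> \<psi>)"
        by (intro mult_left_mono dist_bounded \<open>L \<ge> 0\<close>) auto
      finally show "norm (f r (P (w \<phi> r)) - f r (P (w \<psi> r))) \<le> L * dist \<phi> \<psi> * exp (K * (r - s))"
        by (simp add: mult_ac)
    qed
    also have "\<dots> \<le> L * dist \<phi> \<psi> / K * exp (K * (t - s))"
      using integral_unique[OF expint] \<open>L \<ge> 0\<close> \<open>K > 0\<close> by simp
    also have "L * dist \<phi> \<psi> / K \<le> 1/2 * dist \<phi> \<psi>"
      using \<open>L \<ge> 0\<close> by (simp add: K_def field_simps mult_right_mono)
    finally have D: "norm ?D \<le> 1/2 * dist \<phi> \<psi> * exp (K * (t - s))" by simp
    have "dist (\<Phi> \<phi> u) (\<Phi> \<psi> u) = norm (exp (- K * (t - s)) *\<^sub>R ?D)"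
      by (simp add: \<Phi> t_def[symmetric] T_def dist_norm scaleR_right_distrib scaleR_diff_right)
    also have "\<dots> = exp (- K * (t - s)) * norm ?D" by simp
    also have "\<dots> \<le> exp (- K * (t - s)) * (1/2 * dist \<phi> \<psi> * exp (K * (t - s)))"
      by (intro mult_left_mono D) simp
    also have "\<dots> = 1/2 * dist \<phi> \<psi> * (exp (- K * (t - s)) * exp (K * (t - s)))" by (simp add: mult_ac)
    also have "\<dots> = 1/2 * dist \<phi> \<psi>" by (simp add: exp_add[symmetric])
    finally show "dist (\<Phi> \<phi> u) (\<Phi> \<psi> u) \<le> 1/2 * dist \<phi> \<psi>" .
  qed
  then obtain \<phi> where fp: "\<Phi> \<phi> = \<phi>" using banach_fix_type[of "1/2" \<Phi>] by auto
  have w: "w \<phi> t = x0 + integral {s..t} (\<lambda>r. f r (P (w \<phi> r)))" if "t \<in> {s..b}" for t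
  proof -
    have "\<phi> t = T \<phi> t"
      using \<Phi>[of \<phi> t] fp clamp_cancel_cbox[of t s b] that by (simp add: box_real)
    then have "w \<phi> t = exp (K * (t - s)) *\<^sub>R T \<phi> t" by (simp add: w_def)
    then show ?thesis by (simp add: T_def exp_add[symmetric])
  qed
  have ws: "w \<phi> s = x0" using w[of s] \<open>s \<le> b\<close> by simp
  have wR: "norm (w \<phi> t) \<le> R" if t: "t \<in> {s..b}" for t
  proof -
    have "norm (integral {s..t} (\<lambda>r. f r (P (w \<phi> r)))) \<le> integral {s..t} (\<lambda>_. G)"
      by (rule Henstock_Kurzweil_Integration.integral_norm_bound_integral) (use int G in auto)
    also have "\<dots> = G * (t - s)" using t by simp
    also have "\<dots> \<le> G * step"
      using t A_pos B_pos \<open>R \<ge> 1\<close> by (intro mult_left_mono) (auto simp: b_def G_def)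
    also have "G \<le> (A + B) * R" using \<open>R \<ge> 1\<close> A_pos by (simp add: G_def distrib_right mult_le_cancel_left1)
    then have "G * step \<le> (A + B) * R * step" using step_pos by simp
    also have "\<dots> = R / 2" using step_AB by (simp add: mult_ac)
    finally have "norm (integral {s..t} (\<lambda>r. f r (P (w \<phi> r)))) \<le> R / 2" .
    then have "norm (w \<phi> t) \<le> norm x0 + R / 2"
      unfolding w[OF t] by (intro norm_triangle_mono) auto
    then show ?thesis using R_def by linarith
  qed
  have "integral_solution s {s..b} (w \<phi>)"
    unfolding integral_solution_def
  proof
    fix t assume t: "t \<in> {s..b}"
    have "((\<lambda>r. f r (P (w \<phi> r))) has_integral (w \<phi> t - w \<phi> s)) {s..t}"
      unfolding ws using w[OF t] int by (simp add: has_integral_integral[symmetric])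
    then show "((\<lambda>r. f r (w \<phi> r)) has_integral (w \<phi> t - w \<phi> s)) {s..t}"
      by (rule has_integral_eq[rotated]) (use t wR P_self in auto)
  qed
  then show ?thesis using ws by (auto simp: b_def)
qed

section \<open>Continuation of solutions to all later times\<close>

lemma extend_by_step:
  assumes "0 \<le> \<tau>" "\<tau> \<le> b" and x: "integral_solution \<tau> {\<tau>..b} x"
  shows "\<exists>z. integral_solution \<tau> {\<tau>..b + step} z \<and> (\<forall>t\<in>{\<tau>..b}. z t = x t)"
proof -
  obtain y where y: "y b = x b" "integral_solution b {b..b + step} y"
    using local_existence[of b "x b"] assms by auto
  define z where "z t = (if t \<le> b then x t else y t)" for t
  have left: "((\<lambda>r. f r (z r)) has_integral (z t - z \<tau>)) {\<tau>..t}" if "t \<in> {\<tau>..b}" for t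
  proof -
    have "((\<lambda>r. f r (x r)) has_integral (z t - z \<tau>)) {\<tau>..t}"
      using integral_solutionD[OF x that] that assms by (simp add: z_def)
    then show ?thesis by (rule has_integral_eq[rotated]) (use that in \<open>auto simp: z_def\<close>)
  qed
  have right: "((\<lambda>r. f r (z r)) has_integral (z t - z b)) {b..t}" if "t \<in> {b..b + step}" for t
  proof -
    have "((\<lambda>r. f r (y r)) has_integral (z t - z b)) {b..t}"
      using integral_solutionD[OF y(2) that] that y(1) by (cases "t = b") (auto simp: z_def)
    then show ?thesis by (rule has_integral_eq[rotated]) (use that y(1) in \<open>auto simp: z_def\<close>)
  qed
  have "((\<lambda>r. f r (z r)) has_integral (z t - z \<tau>)) {\<tau>..t}" if "t \<in> {\<tau>..b + step}" for t
  proof (cases "t \<le> b")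
    case True then show ?thesis using left that by simp
  next
    case False
    then show ?thesis
      using has_integral_combine[OF \<open>\<tau> \<le> b\<close> _ left[of b] right[of t]] that \<open>\<tau> \<le> b\<close> by simp
  qed
  then show ?thesis by (intro exI[of _ z]) (auto simp: integral_solution_def z_def)
qed

lemma extend_global:
  assumes "0 \<le> \<tau>" "\<tau> \<le> b" and x: "integral_solution \<tau> {\<tau>..b} x"
  shows "\<exists>z. integral_solution \<tau> {\<tau>..} z \<and> (\<forall>t\<in>{\<tau>..b}. z t = x t)"
proof -
  define e where "e n = b + real n * step" for n
  have e_mono: "e m \<le> e n" if "m \<le> n" for m n using that step_pos by (simp add: e_def)
  have b_le: "b \<le> e n" for n using step_pos by (simp add: e_def)
  have "\<exists>F. \<forall>n. (integral_solution \<tau> {\<tau>..e n} (F n) \<and> (\<forall>t\<in>{\<tau>..b}. F n t = x t)) \<and>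
      (\<forall>t\<in>{\<tau>..e n}. F (Suc n) t = F n t)"
  proof (rule dependent_nat_choice)
    show "\<exists>z. integral_solution \<tau> {\<tau>..e 0} z \<and> (\<forall>t\<in>{\<tau>..b}. z t = x t)"
      using x by (auto simp: e_def)
    fix z n assume z: "integral_solution \<tau> {\<tau>..e n} z \<and> (\<forall>t\<in>{\<tau>..b}. z t = x t)"
    have "\<tau> \<le> e n" using b_le[of n] \<open>\<tau> \<le> b\<close> by linarith
    then obtain y where "integral_solution \<tau> {\<tau>..e n + step} y" "\<forall>t\<in>{\<tau>..e n}. y t = z t"
      using extend_by_step[OF \<open>0 \<le> \<tau>\<close> _ z[THEN conjunct1]] by blast
    moreover have "e n + step = e (Suc n)" by (simp add: e_def algebra_simps)
    ultimately show "\<exists>y. (integral_solution \<tau> {\<tau>..e (Suc n)} y \<and> (\<forall>t\<in>{\<tau>..b}. y t = x t)) \<and>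
        (\<forall>t\<in>{\<tau>..e n}. y t = z t)"
      using z b_le[of n] by (intro exI[of _ y]) auto
  qed
  then obtain F where F: "\<And>n. integral_solution \<tau> {\<tau>..e n} (F n)" "\<And>n t. t \<in> {\<tau>..b} \<Longrightarrow> F n t = x t"
    "\<And>n t. t \<in> {\<tau>..e n} \<Longrightarrow> F (Suc n) t = F n t" by blast
  have F_eq: "F m t = F n t" if "n \<le> m" "t \<in> {\<tau>..e n}" for m n t
    using that(1)
  proof (induction m rule: dec_induct)
    case (step k)
    then show ?case using F(3)[of t k] that(2) e_mono[of n k] by simp
  qed simp
  \<comment> \<open>The index is the least n with \<open>t \<le> e n\<close>; \<open>nat\<close>
    sends negative values to 0, so \<open>F 0\<close> is used up to \<open>b\<close>.\<close>
  define z where "z t = F (nat \<lceil>(t - b) / step\<rceil>) t" for t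
  have le_e: "t \<le> e (nat \<lceil>(t - b) / step\<rceil>)" for t
  proof -
    have "(t - b) / step \<le> real (nat \<lceil>(t - b) / step\<rceil>)" by linarith
    then show ?thesis using step_pos by (simp add: e_def field_simps)
  qed
  have z_eq: "z t = F n t" if "t \<in> {\<tau>..e n}" for t n
  proof (cases "n \<le> nat \<lceil>(t - b) / step\<rceil>")
    case True then show ?thesis unfolding z_def using that by (rule F_eq)
  next
    case False
    then have "nat \<lceil>(t - b) / step\<rceil> \<le> n" by (simp only: not_le less_imp_le)
    then show ?thesis unfolding z_def
      by (rule F_eq[symmetric]) (use that le_e[of t] in simp)
  qed
  have "((\<lambda>r. f r (z r)) has_integral (z t - z \<tau>)) {\<tau>..t}" if "\<tau> \<le> t" for t
  proof -
    obtain n where "t \<le> e n" using le_e by blast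
    then have "((\<lambda>r. f r (F n r)) has_integral (z t - z \<tau>)) {\<tau>..t}"
      using integral_solutionD[OF F(1)[of n], of t] z_eq[of t n] z_eq[of \<tau> n] that by simp
    then show ?thesis
      by (rule has_integral_eq[rotated]) (use z_eq[of _ n] \<open>t \<le> e n\<close> in auto)
  qed
  moreover have "z t = x t" if "t \<in> {\<tau>..b}" for t
    using z_eq[of t 0] F(2)[OF that, of 0] that by (simp add: e_def)
  ultimately show ?thesis by (intro exI[of _ z]) (auto simp: integral_solution_def)
qed

text \<open>An absorption argument replaces Gronwall's inequality. On a last window of length at
  most \<open>step\<close>, the largest norm m over [c, t] satisfies m <= |x c| + 1/2 + m/2, and the
  term m/2 is absorbed; the resulting bound does not depend on t < b.\<close>

lemma integral_solution_bounded:
  assumes "0 \<le> \<tau>" "\<tau> < b" and x: "integral_solution \<tau> {\<tau>..<b} x"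
  obtains m where "\<And>t. t \<in> {\<tau>..<b} \<Longrightarrow> norm (x t) \<le> m"
proof -
  define c where "c = max \<tau> (b - step)"
  have c: "\<tau> \<le> c" "c < b" "b \<le> c + step" using assms step_pos by (auto simp: c_def)
  have cont: "continuous_on {\<tau>..t} x" if "t \<in> {\<tau>..<b}" for t
    by (rule integral_solution_continuous_on[OF x that]) (use that in auto)
  have near: "norm (x t) \<le> 2 * norm (x c) + 1" if t: "t \<in> {c..<b}" for t
  proof -
    have "continuous_on {c..t} (\<lambda>r. norm (x r))"
      using cont[of t] t c by (intro continuous_intros) (auto elim: continuous_on_subset)
    then obtain p where p: "p \<in> {c..t}" "\<And>r. r \<in> {c..t} \<Longrightarrow> norm (x r) \<le> norm (x p)"
      using continuous_attains_sup[of "{c..t}" "\<lambda>r. norm (x r)"] t by auto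
    have "norm (x p - x c) \<le> (A + B * norm (x p)) * (p - c)"
      by (rule integral_solution_bound[OF x]) (use p t c \<open>0 \<le> \<tau>\<close> in auto)
    also have "\<dots> \<le> (A + B * norm (x p)) * step"
      using p(1) t c A_pos B_pos by (intro mult_left_mono) auto
    also have "\<dots> = step * A + step * B * norm (x p)" by (simp add: algebra_simps)
    also have "\<dots> \<le> 1/2 + 1/2 * norm (x p)"
      using step_A mult_right_mono[OF step_B norm_ge_zero[of "x p"]] by linarith
    finally have "norm (x p) \<le> 2 * norm (x c) + 1"
      using norm_triangle_ineq2[of "x p" "x c"] by linarith
    then show ?thesis using p(2)[of t] t by simp
  qed
  have "compact (x ` {\<tau>..c})" using cont[of c] c by (intro compact_continuous_image) auto
  then obtain m where m: "\<And>t. t \<in> {\<tau>..c} \<Longrightarrow> norm (x t) \<le> m"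
    using compact_imp_bounded bounded_iff by (metis imageI)
  have "norm (x t) \<le> max m (2 * norm (x c) + 1)" if "t \<in> {\<tau>..<b}" for t
    using m[of t] near[of t] that by (cases "t \<le> c") auto
  then show ?thesis by (rule that)
qed

text \<open>Boundedness makes the field integrable up to \<open>b\<close>, and this integral
  dictates the missing value. The zero extension \<open>y\<close> differs from \<open>z\<close> on
  [\<open>\<tau>\<close>, b] only at \<open>b\<close>, which no integral notices.\<close>

lemma extend_to_endpoint:
  assumes "0 \<le> \<tau>" "\<tau> < b" and x: "integral_solution \<tau> {\<tau>..<b} x"
  shows "\<exists>z. integral_solution \<tau> {\<tau>..b} z \<and> (\<forall>t\<in>{\<tau>..<b}. z t = x t)"
proof -
  obtain m where m: "\<And>t. t \<in> {\<tau>..<b} \<Longrightarrow> norm (x t) \<le> m"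
    using integral_solution_bounded[OF assms] by blast
  define y where "y t = (if t \<in> {\<tau>..<b} then x t else 0)" for t
  have "continuous_on {\<tau>..<b} x"
    unfolding continuous_on_eq_continuous_within
  proof
    fix t assume t: "t \<in> {\<tau>..<b}"
    define u where "u = (t + b) / 2"
    have u: "t < u" "u < b" using t by (auto simp: u_def)
    have "continuous_on {\<tau>..u} x"
      by (rule integral_solution_continuous_on[OF x]) (use t u in auto)
    then have "continuous (at t within {\<tau>..u}) x"
      using t u by (simp add: continuous_on_eq_continuous_within)
    moreover have "at t within {\<tau>..u} = at t within {\<tau>..<b}"
      by (rule at_within_nhd[of _ "{..<u}"]) (use t u in auto)
    ultimately show "continuous (at t within {\<tau>..<b}) x" by simp
  qed
  then have "y \<in> borel_measurable lebesgue"
    unfolding y_def[abs_def]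
    by (intro borel_measurable_if_I continuous_imp_measurable_on_sets_lebesgue) auto
  then have "y \<in> borel_measurable (lebesgue_on {0..})"
    by (rule measurable_restrict_space1)
  moreover have "norm (f r (y r)) \<le> A + B * \<bar>m\<bar>" if "r \<in> {\<tau>..b}" for r
  proof -
    have "norm (f r (y r)) \<le> A + B * norm (y r)" using growth that \<open>0 \<le> \<tau>\<close> by simp
    also have "norm (y r) \<le> \<bar>m\<bar>" using m[of r] by (auto simp: y_def)
    then have "A + B * norm (y r) \<le> A + B * \<bar>m\<bar>" using B_pos by simp
    finally show ?thesis .
  qed
  ultimately have int: "(\<lambda>r. f r (y r)) integrable_on {\<tau>..b}"
    by (rule superposition_integrable[OF _ \<open>0 \<le> \<tau>\<close>])
  define z where "z t = (if t = b then x \<tau> + integral {\<tau>..b} (\<lambda>r. f r (y r)) else x t)" for t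
  have "((\<lambda>r. f r (z r)) has_integral (z t - z \<tau>)) {\<tau>..t}" if "t \<in> {\<tau>..b}" for t
  proof (cases "t = b")
    case True
    have "((\<lambda>r. f r (y r)) has_integral (z b - z \<tau>)) {\<tau>..b}"
      using int \<open>\<tau> < b\<close> by (simp add: z_def has_integral_integral[symmetric])
    then show ?thesis unfolding True
      by (rule has_integral_spike_finite[of "{b}", rotated 2]) (auto simp: z_def y_def)
  next
    case False
    then have "((\<lambda>r. f r (x r)) has_integral (z t - z \<tau>)) {\<tau>..t}"
      using integral_solutionD[OF x, of t] that \<open>\<tau> < b\<close> by (simp add: z_def)
    then show ?thesis by (rule has_integral_eq[rotated]) (use that False in \<open>auto simp: z_def\<close>)
  qed
  then show ?thesis by (intro exI[of _ z]) (auto simp: integral_solution_def z_def)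
qed

text \<open>An interval with least element \<open>\<tau>\<close> is [\<open>\<tau>\<close>, oo),
  [\<open>\<tau>\<close>, b] or [\<open>\<tau>\<close>, b) with b its supremum. The half-open case
  is first closed at b; the singleton is the closed case with b = \<open>\<tau>\<close>.\<close>

theorem forward_complete: "forward_complete f"
  unfolding forward_complete_def
proof (intro allI impI)
  fix \<tau> :: real and J x
  assume "0 \<le> \<tau>" "\<tau> \<in> J" "J \<subseteq> {\<tau>..}" and x: "caratheodory_solution f J x"
  have "is_interval J" using x by (simp add: caratheodory_solution_def)
  then have J: "{\<tau>..t} \<subseteq> J" if "t \<in> J" for t
    using \<open>\<tau> \<in> J\<close> that mem_is_interval_1_I by (metis atLeastAtMost_iff subsetI)
  have sol: "integral_solution \<tau> J x"
    unfolding integral_solution_def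
    using caratheodory_solution_has_integral[OF x J] \<open>J \<subseteq> {\<tau>..}\<close> by auto
  show "\<exists>z. caratheodory_solution f {\<tau>..} z \<and> (\<forall>t\<in>J. z t = x t)"
  proof (cases "bdd_above J")
    case False
    have "J = {\<tau>..}"
    proof (intro equalityI \<open>J \<subseteq> {\<tau>..}\<close> subsetI)
      fix t assume "t \<in> {\<tau>..}"
      moreover obtain u where "u \<in> J" "t < u" using False by (meson bdd_above.I linorder_not_less)
      ultimately show "t \<in> J" using J[of u] by auto
    qed
    with x show ?thesis by blast
  next
    case True
    define b where "b = Sup J"
    have "\<tau> \<le> b" using cSup_upper[OF \<open>\<tau> \<in> J\<close> True] by (simp add: b_def)
    have J_le: "J \<subseteq> {\<tau>..b}" using \<open>J \<subseteq> {\<tau>..}\<close> cSup_upper[OF _ True] by (auto simp: b_def)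
    have J_ge: "{\<tau>..<b} \<subseteq> J"
    proof
      fix t assume "t \<in> {\<tau>..<b}"
      moreover obtain u where "u \<in> J" "t < u"
        using less_cSup_iff[of J t] True \<open>\<tau> \<in> J\<close> calculation by (auto simp: b_def)
      ultimately show "t \<in> J" using J[of u] by auto
    qed
    have "\<exists>y. integral_solution \<tau> {\<tau>..b} y \<and> (\<forall>t\<in>J. y t = x t)"
    proof (cases "b \<in> J")
      case True
      then have "J = {\<tau>..b}" using J_le J[of b] by blast
      with sol show ?thesis by blast
    next
      case False
      have "J = {\<tau>..<b}"
        using J_ge subsetD[OF J_le] False by (intro equalityI) (auto simp: less_le)
      moreover have "\<tau> < b" using False \<open>\<tau> \<in> J\<close> \<open>\<tau> \<le> b\<close> by (cases "\<tau> = b") auto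
      ultimately show ?thesis using extend_to_endpoint[OF \<open>0 \<le> \<tau>\<close>, of b x] sol by simp
    qed
    then obtain y where y: "integral_solution \<tau> {\<tau>..b} y" "\<forall>t\<in>J. y t = x t" by blast
    then obtain z where z: "integral_solution \<tau> {\<tau>..} z" "\<forall>t\<in>{\<tau>..b}. z t = y t"
      using extend_global[OF \<open>0 \<le> \<tau>\<close> \<open>\<tau> \<le> b\<close>] by blast
    show ?thesis
      using integral_solution_imp_caratheodory_solution[OF \<open>0 \<le> \<tau>\<close> z(1)] z(2) y(2) J_le
      by (intro exI[of _ z]) auto
  qed
qed

end

section \<open>The saturated feedback\<close>

lemma sat_eq: "sat x = max (- 1) (min 1 x)"
  by (cases "x < - 1"; cases "x > 1") (auto simp: sat_def max_def min_def abs_if)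

lemma abs_sat_le_1: "\<bar>sat x\<bar> \<le> 1"
  by (auto simp: sat_eq)

lemma sat_lipschitz: "\<bar>sat x - sat y\<bar> \<le> \<bar>x - y\<bar>"
  by (auto simp: sat_eq)

lemma continuous_on_sat [continuous_intros]:
  "continuous_on S g \<Longrightarrow> continuous_on S (\<lambda>x. sat (g x))"
  unfolding sat_eq by (intro continuous_intros)

lemma borel_measurable_sat [measurable]: "sat \<in> borel_measurable borel"
  by (intro borel_measurable_continuous_onI continuous_intros)

lemma mult_sat_ge_power2: "(sat x)\<^sup>2 \<le> x * sat x"
  by (auto simp: sat_eq power2_eq_square max_def min_def)

lemma sat_unsaturated: "\<bar>x\<bar> \<le> 1 \<Longrightarrow> sat x = x"
  by (simp add: sat_def max_absorb1)

lemma mult_sat_unsaturated: "k > 0 \<Longrightarrow> k * \<bar>y\<bar> \<le> 1 \<Longrightarrow> y * sat (k * y) = k * y\<^sup>2"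
  by (subst sat_unsaturated) (auto simp: abs_mult power2_eq_square)

lemma mult_sat_saturated: "k > 0 \<Longrightarrow> k * \<bar>y\<bar> \<ge> 1 \<Longrightarrow> y * sat (k * y) = \<bar>y\<bar>"
  by (cases "y \<ge> 0") (auto simp: sat_def abs_mult max_absorb2)

lemma mult_sat_nonneg: "k > 0 \<Longrightarrow> y * sat (k * y) \<ge> 0"
  using mult_sat_unsaturated[of k y] mult_sat_saturated[of k y] by (cases "k * \<bar>y\<bar> \<le> 1") auto

text \<open>In the saturated regime the product is |y|, and |y| >= y^2 / R as long as |y| <= R; the
  minimum of the two slopes serves both regimes.\<close>

lemma mult_sat_ge_on_bounded:
  assumes "k > 0" "\<bar>y\<bar> \<le> R" "R > 0"
  shows "min k (1 / R) * y\<^sup>2 \<le> y * sat (k * y)"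
proof (cases "k * \<bar>y\<bar> \<le> 1")
  case True
  then show ?thesis using mult_sat_unsaturated[OF \<open>k > 0\<close> True] by (simp add: mult_right_mono)
next
  case False
  have "min k (1 / R) * y\<^sup>2 \<le> 1 / R * y\<^sup>2" by (intro mult_right_mono) auto
  also have "\<dots> = 1 / R * (\<bar>y\<bar> * \<bar>y\<bar>)" by (simp add: power2_eq_square)
  also have "\<dots> \<le> 1 / R * (\<bar>y\<bar> * R)"
    using assms by (intro mult_left_mono) auto
  also have "\<dots> = \<bar>y\<bar>" using \<open>R > 0\<close> by simp
  finally show ?thesis using mult_sat_saturated[of k y] assms False by simp
qed

lemma sin_lipschitz: "\<bar>sin x - sin y\<bar> \<le> \<bar>x - y :: real\<bar>"
proof -
  have "\<bar>sin x - sin y\<bar> = 2 * (\<bar>sin ((x - y) / 2)\<bar> * \<bar>cos ((x + y) / 2)\<bar>)"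
    by (simp add: sin_diff_sin abs_mult)
  also have "\<dots> \<le> 2 * (\<bar>(x - y) / 2\<bar> * 1)"
    by (intro mult_left_mono mult_mono abs_sin_x_le_abs_x) auto
  finally show ?thesis by simp
qed

lemma cos_lipschitz: "\<bar>cos x - cos y\<bar> \<le> \<bar>x - y :: real\<bar>"
proof -
  have "\<bar>cos x - cos y\<bar> = 2 * (\<bar>sin ((y - x) / 2)\<bar> * \<bar>sin ((x + y) / 2)\<bar>)"
    by (simp add: cos_diff_cos abs_mult)
  also have "\<dots> \<le> 2 * (\<bar>(y - x) / 2\<bar> * 1)"
    by (intro mult_left_mono mult_mono abs_sin_x_le_abs_x) auto
  finally show ?thesis by simp
qed

lemma abs_cos_minus_one_le: "\<bar>cos x - 1\<bar> \<le> x\<^sup>2 / 2" for x :: real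
proof -
  have "cos x = 1 - 2 * (sin (x / 2))\<^sup>2" using cos_double_sin[of "x / 2"] by simp
  moreover have "(sin (x / 2))\<^sup>2 \<le> (x / 2)\<^sup>2"
    using abs_sin_x_le_abs_x[of "x / 2"] by (simp only: abs_le_square_iff)
  ultimately show ?thesis by (simp add: power_divide)
qed

lemma abs_sin_minus_id_le: "\<bar>sin x - x\<bar> \<le> \<bar>x\<bar> ^ 3 / 6" for x :: real
  using Maclaurin_sin_bound[of x 3]
  by (simp add: sin_coeff_def numeral_3_eq_3 fact_numeral field_simps)

text \<open>The only unbounded terms are the products of \<open>lam\<close> with y1 and y2; they
  account for the factor 2 in the growth constant, and the summand 1 keeps it positive when
  \<open>k = 0\<close>. Since \<open>lam\<close> itself varies with y1, their Lipschitz constant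
  depends on the ball.\<close>

lemma closed_loop_caratheodory_field:
  assumes "C1 > 0" "\<beta> > 0" "M > 0" "C0 > 0" "C2 > 0" "\<rho> > 0" "k \<ge> 0"
    and \<kappa>: "\<kappa> \<in> borel_measurable (lebesgue_on {0..})" "\<And>t. t \<ge> 0 \<Longrightarrow> \<bar>\<kappa> t\<bar> \<le> k"
  shows "caratheodory_field (closed_loop C1 \<beta> M C0 C2 \<rho> \<kappa>) (3 + C1 + \<beta>) (2 * ((1 + C1) * k) + 1)"
proof
  define \<Lambda> where "\<Lambda> = (1 + C1) * k"
  have "\<Lambda> \<ge> 0" using assms by (simp add: \<Lambda>_def)
  define lam where "lam t y = (1 + C1 * sat (M * y)) * \<kappa> t" for t y
  have u: "\<bar>1 + C1 * sat y\<bar> \<le> 1 + C1" "\<bar>C1 * sat y\<bar> \<le> C1" for y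
  proof -
    have "C1 * \<bar>sat y\<bar> \<le> C1 * 1" using \<open>C1 > 0\<close> by (intro mult_left_mono abs_sat_le_1) simp
    then show "\<bar>C1 * sat y\<bar> \<le> C1" using \<open>C1 > 0\<close> by (simp add: abs_mult)
    then show "\<bar>1 + C1 * sat y\<bar> \<le> 1 + C1" by linarith
  qed
  have lam: "\<bar>lam t y\<bar> \<le> \<Lambda>" if "t \<ge> 0" for t y
    unfolding lam_def \<Lambda>_def abs_mult
    using u(1) \<kappa>(2)[OF that] \<open>C1 > 0\<close> by (intro mult_mono) auto
  have cl: "closed_loop C1 \<beta> M C0 C2 \<rho> \<kappa> t (y1, y2, \<xi>) =
      (- C1 * sat (M * y1) + lam t y1 * y2 + (cos \<xi> - 1), sin \<xi> - lam t y1 * y1,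
        - \<beta> * sat (C0 / \<beta> * (\<xi> + \<rho> * sat (C2 * y2))))" for t y1 y2 \<xi>
    by (simp add: closed_loop_def Let_def lam_def)
  have norm3: "norm (a, b, c) \<le> \<bar>a\<bar> + \<bar>b\<bar> + \<bar>c\<bar>" for a b c :: real
    using norm_Pair_le[of a "(b, c)"] norm_Pair_le[of b c] by simp
  have comps: "\<bar>a\<bar> \<le> norm (a, b, c)" "\<bar>b\<bar> \<le> norm (a, b, c)" "\<bar>c\<bar> \<le> norm (a, b, c)" for a b c :: real
    using norm_fst_le[of a "(b, c)"] norm_snd_le[of "(b, c)" a] norm_fst_le[of b c] norm_snd_le[of c b]
    by auto
  show "0 < 3 + C1 + \<beta>" "0 < 2 * ((1 + C1) * k) + 1"
    using assms \<open>\<Lambda> \<ge> 0\<close> unfolding \<Lambda>_def by linarith+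
  show "norm (closed_loop C1 \<beta> M C0 C2 \<rho> \<kappa> t x) \<le> 3 + C1 + \<beta> + (2 * ((1 + C1) * k) + 1) * norm x"
    if "t \<ge> 0" for t x
  proof -
    obtain y1 y2 \<xi> where x: "x = (y1, y2, \<xi>)" by (cases x)
    have l: "\<bar>lam t y1 * y\<bar> \<le> \<Lambda> * norm x" if "\<bar>y\<bar> \<le> norm x" for y
      unfolding abs_mult using lam[OF \<open>t \<ge> 0\<close>] that \<open>\<Lambda> \<ge> 0\<close> by (intro mult_mono) auto
    have l1: "\<bar>lam t y1 * y1\<bar> \<le> \<Lambda> * norm x" and l2: "\<bar>lam t y1 * y2\<bar> \<le> \<Lambda> * norm x"
      by (rule l; simp only: x comps)+
    have "\<bar>- C1 * sat (M * y1) + lam t y1 * y2 + (cos \<xi> - 1)\<bar> \<le> C1 + \<Lambda> * norm x + 2"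
      using u(2)[of "M * y1"] l2 cos_le_one[of \<xi>] cos_ge_minus_one[of \<xi>] by linarith
    moreover have "\<bar>sin \<xi> - lam t y1 * y1\<bar> \<le> 1 + \<Lambda> * norm x"
      using l1 abs_sin_le_one[of \<xi>] by linarith
    moreover have "\<bar>- \<beta> * sat (C0 / \<beta> * (\<xi> + \<rho> * sat (C2 * y2)))\<bar> \<le> \<beta>"
      using mult_left_mono[OF abs_sat_le_1, of \<beta>] \<open>\<beta> > 0\<close> by (simp add: abs_mult)
    ultimately have "norm (closed_loop C1 \<beta> M C0 C2 \<rho> \<kappa> t x) \<le> 3 + C1 + \<beta> + 2 * (\<Lambda> * norm x)"
      unfolding x cl using norm3 by (smt (verit))
    moreover have "(2 * ((1 + C1) * k) + 1) * norm x = 2 * (\<Lambda> * norm x) + norm x"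
      by (simp add: \<Lambda>_def algebra_simps)
    ultimately show ?thesis using norm_ge_zero[of x] by linarith
  qed
  show "\<exists>L\<ge>0. \<forall>t\<ge>0. \<forall>x\<in>cball 0 R. \<forall>y\<in>cball 0 R.
      norm (closed_loop C1 \<beta> M C0 C2 \<rho> \<kappa> t x - closed_loop C1 \<beta> M C0 C2 \<rho> \<kappa> t y) \<le> L * norm (x - y)" for R
  proof (intro exI conjI allI impI ballI)
    define Q where "Q = \<Lambda> + C1 * M * k * \<bar>R\<bar>"
    have "Q \<ge> 0" using assms \<open>\<Lambda> \<ge> 0\<close> by (simp add: Q_def)
    show "0 \<le> (C1 * M + Q + 1) + (1 + Q) + C0 * (1 + \<rho> * C2)" using assms \<open>Q \<ge> 0\<close> by simp
    fix t :: real and x y :: "real \<times> real \<times> real"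
    assume "t \<ge> 0" "x \<in> cball 0 R" "y \<in> cball 0 R"
    obtain a b c where x: "x = (a, b, c)" by (cases x)
    obtain a' b' c' where y: "y = (a', b', c')" by (cases y)
    define D where "D = norm (x - y)"
    have D: "\<bar>a - a'\<bar> \<le> D" "\<bar>b - b'\<bar> \<le> D" "\<bar>c - c'\<bar> \<le> D" "D \<ge> 0"
      by (simp_all only: D_def x y diff_Pair comps norm_ge_zero)
    have "norm (a, b, c) \<le> \<bar>R\<bar>" "norm (a', b', c') \<le> \<bar>R\<bar>"
      using \<open>x \<in> cball 0 R\<close> \<open>y \<in> cball 0 R\<close> by (auto simp: x y)
    then have Rb: "\<bar>a'\<bar> \<le> \<bar>R\<bar>" "\<bar>b'\<bar> \<le> \<bar>R\<bar>"
      by (meson comps order_trans)+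
    have ds: "\<bar>sat (K * p) - sat (K * q)\<bar> \<le> K * D" if "K > 0" "\<bar>p - q\<bar> \<le> D" for K p q
    proof -
      have "\<bar>sat (K * p) - sat (K * q)\<bar> \<le> \<bar>K * p - K * q\<bar>" by (rule sat_lipschitz)
      also have "\<dots> = K * \<bar>p - q\<bar>" using \<open>K > 0\<close> by (simp add: abs_mult right_diff_distrib[symmetric])
      also have "\<dots> \<le> K * D" using that by (intro mult_left_mono) auto
      finally show ?thesis .
    qed
    have d1: "\<bar>C1 * sat (M * a) - C1 * sat (M * a')\<bar> \<le> C1 * M * D"
      using mult_left_mono[OF ds[OF \<open>M > 0\<close> D(1)], of C1] \<open>C1 > 0\<close>
      by (simp add: abs_mult right_diff_distrib[symmetric] mult.assoc)
    have "\<bar>lam t a - lam t a'\<bar> = \<bar>C1 * sat (M * a) - C1 * sat (M * a')\<bar> * \<bar>\<kappa> t\<bar>"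
      by (simp add: lam_def abs_mult[symmetric] algebra_simps)
    also have "\<dots> \<le> C1 * M * D * k"
      using assms D by (intro mult_mono d1 \<kappa>(2)[OF \<open>t \<ge> 0\<close>]) auto
    finally have dlam: "\<bar>lam t a - lam t a'\<bar> \<le> C1 * M * D * k" .
    have dprod: "\<bar>lam t a * p - lam t a' * p'\<bar> \<le> Q * D" if "\<bar>p'\<bar> \<le> \<bar>R\<bar>" "\<bar>p - p'\<bar> \<le> D" for p p'
    proof -
      have "\<bar>lam t a * p - lam t a' * p'\<bar> = \<bar>lam t a * (p - p') + (lam t a - lam t a') * p'\<bar>"
        by (simp add: algebra_simps)
      also have "\<dots> \<le> \<bar>lam t a\<bar> * \<bar>p - p'\<bar> + \<bar>lam t a - lam t a'\<bar> * \<bar>p'\<bar>"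
        by (metis abs_mult abs_triangle_ineq)
      also have "\<dots> \<le> \<Lambda> * D + C1 * M * D * k * \<bar>R\<bar>"
        using that lam[OF \<open>t \<ge> 0\<close>] dlam assms D \<open>\<Lambda> \<ge> 0\<close> by (intro add_mono mult_mono) auto
      also have "\<dots> = Q * D" by (simp add: Q_def algebra_simps)
      finally show ?thesis .
    qed
    have "\<bar>(- C1 * sat (M * a) + lam t a * b + (cos c - 1)) - (- C1 * sat (M * a') + lam t a' * b' + (cos c' - 1))\<bar>
        \<le> C1 * M * D + Q * D + D"
      using d1 dprod[OF Rb(2) D(2)] cos_lipschitz[of c c'] D(3) by linarith
    moreover have "\<bar>(sin c - lam t a * a) - (sin c' - lam t a' * a')\<bar> \<le> D + Q * D"
      using dprod[OF Rb(1) D(1)] sin_lipschitz[of c c'] D(3) by linarith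
    moreover have "\<bar>- \<beta> * sat (C0 / \<beta> * (c + \<rho> * sat (C2 * b))) - (- \<beta> * sat (C0 / \<beta> * (c' + \<rho> * sat (C2 * b'))))\<bar>
        \<le> C0 * (1 + \<rho> * C2) * D"
    proof -
      let ?p = "c + \<rho> * sat (C2 * b)" and ?q = "c' + \<rho> * sat (C2 * b')"
      have "\<rho> * \<bar>sat (C2 * b) - sat (C2 * b')\<bar> \<le> \<rho> * (C2 * D)"
        using \<open>\<rho> > 0\<close> by (intro mult_left_mono ds[OF \<open>C2 > 0\<close> D(2)]) simp
      then have "\<bar>\<rho> * sat (C2 * b) - \<rho> * sat (C2 * b')\<bar> \<le> \<rho> * C2 * D"
        using \<open>\<rho> > 0\<close> by (simp add: right_diff_distrib[symmetric] abs_mult)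
      then have pq: "\<bar>?p - ?q\<bar> \<le> (1 + \<rho> * C2) * D" using D(3) by (simp add: algebra_simps)
      have "\<bar>- \<beta> * sat (C0 / \<beta> * ?p) - (- \<beta> * sat (C0 / \<beta> * ?q))\<bar>
          = \<bar>\<beta> * (sat (C0 / \<beta> * ?p) - sat (C0 / \<beta> * ?q))\<bar>"
        by (subst abs_minus_commute) (simp add: algebra_simps)
      also have "\<dots> = \<beta> * \<bar>sat (C0 / \<beta> * ?p) - sat (C0 / \<beta> * ?q)\<bar>"
        using \<open>\<beta> > 0\<close> by (simp add: abs_mult)
      also have "\<dots> \<le> \<beta> * \<bar>C0 / \<beta> * ?p - C0 / \<beta> * ?q\<bar>"
        using \<open>\<beta> > 0\<close> by (intro mult_left_mono sat_lipschitz) simp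
      also have "\<dots> = C0 * \<bar>?p - ?q\<bar>"
        using \<open>\<beta> > 0\<close> \<open>C0 > 0\<close> by (simp only: right_diff_distrib[symmetric] abs_mult) simp
      also have "\<dots> \<le> C0 * ((1 + \<rho> * C2) * D)" using pq \<open>C0 > 0\<close> by (intro mult_left_mono) auto
      finally show ?thesis by (simp only: mult.assoc)
    qed
    ultimately have "norm (closed_loop C1 \<beta> M C0 C2 \<rho> \<kappa> t x - closed_loop C1 \<beta> M C0 C2 \<rho> \<kappa> t y)
        \<le> (C1 * M * D + Q * D + D) + (D + Q * D) + C0 * (1 + \<rho> * C2) * D"
      unfolding x y cl diff_Pair by (intro norm3[THEN order_trans] add_mono)
    then show "norm (closed_loop C1 \<beta> M C0 C2 \<rho> \<kappa> t x - closed_loop C1 \<beta> M C0 C2 \<rho> \<kappa> t y)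
        \<le> ((C1 * M + Q + 1) + (1 + Q) + C0 * (1 + \<rho> * C2)) * norm (x - y)"
      by (simp add: D_def algebra_simps)
  qed
  show "(\<lambda>t. closed_loop C1 \<beta> M C0 C2 \<rho> \<kappa> t (\<phi> t)) \<in> borel_measurable (lebesgue_on {0..})"
    if [measurable]: "\<phi> \<in> borel_measurable (lebesgue_on {0..})" for \<phi>
  proof -
    note \<kappa>(1)[measurable]
    have [measurable]: "(\<lambda>t. fst (\<phi> t)) \<in> borel_measurable (lebesgue_on {0..})"
      "(\<lambda>t. fst (snd (\<phi> t))) \<in> borel_measurable (lebesgue_on {0..})"
      "(\<lambda>t. snd (snd (\<phi> t))) \<in> borel_measurable (lebesgue_on {0..})"
      by (rule borel_measurable_continuous_on[OF _ that]; intro continuous_intros)+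
    have "(\<lambda>t. closed_loop C1 \<beta> M C0 C2 \<rho> \<kappa> t (\<phi> t)) =
      (\<lambda>t. (- C1 * sat (M * fst (\<phi> t)) + (1 + C1 * sat (M * fst (\<phi> t))) * \<kappa> t * fst (snd (\<phi> t)) + (cos (snd (snd (\<phi> t))) - 1),
        sin (snd (snd (\<phi> t))) - (1 + C1 * sat (M * fst (\<phi> t))) * \<kappa> t * fst (\<phi> t),
        - \<beta> * sat (C0 / \<beta> * (snd (snd (\<phi> t)) + \<rho> * sat (C2 * fst (snd (\<phi> t)))))))"
      by (simp add: closed_loop_def Let_def case_prod_unfold)
    then show ?thesis by simp
  qed
qed

section \<open>Lyapunov analysis\<close>

lemma norm_snd_snd_le: "norm (snd (snd x)) \<le> norm x"
  by (metis norm_snd_le order_trans prod.collapse)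

text \<open>\<open>L\<close> bounds |lam|. On |xi| <= 2 rho, \<open>rho_beta\<close> keeps the
  bracket of the feedback, at most 3 rho, in the linear range. \<open>rho_C1\<close> says (1 + L) 2
  rho <= C1 / 2, for saturated y1; \<open>M_def\<close> says C1 M / 2 = 2 (1 + L)^2, for Young's
  inequality at unsaturated y1. \<open>C2_def\<close> gives 2 rho^2 C2 = rho / 4 and rho C2 / 4 = 1
  / 32, the two amounts spent on cross terms with y2.\<close>

locale path_following =
  fixes C1 \<beta> L \<rho> C2 M k :: real and \<kappa> :: "real \<Rightarrow> real"
  assumes C1_pos: "C1 > 0" and rho_pos: "\<rho> > 0" and rho_le: "\<rho> \<le> 1 / 4"
    and rho_beta: "3 * \<rho> \<le> \<beta>" and rho_C1: "4 * \<rho> * (1 + L) \<le> C1"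
    and k_nonneg: "k \<ge> 0" and L_def: "L = (1 + C1) * k"
    and C2_def: "C2 = 1 / (8 * \<rho>)" and M_def: "M = 4 * (1 + L)\<^sup>2 / C1"
    and kappa_bound: "t \<ge> 0 \<Longrightarrow> \<bar>\<kappa> t\<bar> \<le> k"
begin

lemma L_nonneg: "L \<ge> 0" using C1_pos k_nonneg by (simp add: L_def)
lemma beta_pos: "\<beta> > 0" using rho_beta rho_pos by linarith
lemma C2_pos: "C2 > 0" using rho_pos by (simp add: C2_def)
lemma M_pos: "M > 0" using C1_pos L_nonneg by (simp add: M_def)

abbreviation field :: "real \<Rightarrow> real \<times> real \<times> real \<Rightarrow> real \<times> real \<times> real" where
  "field \<equiv> closed_loop C1 \<beta> M 1 C2 \<rho> \<kappa>"

definition lam :: "real \<Rightarrow> real \<Rightarrow> real" where "lam t y1 = (1 + C1 * sat (M * y1)) * \<kappa> t"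

definition u2 :: "real \<Rightarrow> real \<Rightarrow> real" where
  "u2 y2 \<xi> = - \<beta> * sat (1 / \<beta> * (\<xi> + \<rho> * sat (C2 * y2)))"

lemma field_eq: "field t (y1, y2, \<xi>) =
    (- C1 * sat (M * y1) + lam t y1 * y2 + (cos \<xi> - 1), sin \<xi> - lam t y1 * y1, u2 y2 \<xi>)"
  by (simp add: closed_loop_def Let_def lam_def u2_def)

lemma lam_bound:
  assumes "t \<ge> 0" shows "\<bar>lam t y1\<bar> \<le> L"
proof -
  have "\<bar>C1 * sat (M * y1)\<bar> \<le> C1 * 1"
    unfolding abs_mult using C1_pos abs_sat_le_1 by (intro mult_mono) auto
  then have "\<bar>1 + C1 * sat (M * y1)\<bar> \<le> 1 + C1" by linarith
  then show ?thesis
    unfolding lam_def L_def abs_mult using kappa_bound[OF assms] C1_pos by (intro mult_mono) auto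
qed

lemma u2_unsaturated:
  assumes "\<bar>\<xi>\<bar> \<le> 2 * \<rho>"
  shows "u2 y2 \<xi> = - (\<xi> + \<rho> * sat (C2 * y2))"
proof -
  have "\<bar>\<rho> * sat (C2 * y2)\<bar> \<le> \<rho> * 1"
    unfolding abs_mult using rho_pos abs_sat_le_1 by (intro mult_mono) auto
  then have "\<bar>\<xi> + \<rho> * sat (C2 * y2)\<bar> \<le> \<beta>" using assms rho_beta by linarith
  then have "\<bar>1 / \<beta> * (\<xi> + \<rho> * sat (C2 * y2))\<bar> \<le> 1" using beta_pos by (simp add: abs_mult)
  then show ?thesis using beta_pos by (simp add: u2_def sat_unsaturated)
qed

text \<open>The term with \<open>sat\<close> is at most rho, so the bracket keeps the sign of xi and
  has size at least rho. As rho <= beta, clipping at beta leaves a speed of at least rho.\<close>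

lemma u2_contracting:
  assumes "\<bar>\<xi>\<bar> \<ge> 2 * \<rho>"
  shows "\<xi> * u2 y2 \<xi> \<le> - 2 * \<rho>\<^sup>2"
proof -
  define z where "z = \<xi> + \<rho> * sat (C2 * y2)"
  have s: "\<bar>\<rho> * sat (C2 * y2)\<bar> \<le> \<rho> * 1"
    unfolding abs_mult using rho_pos abs_sat_le_1 by (intro mult_mono) auto
  have u2: "u2 y2 \<xi> = max (- \<beta>) (min \<beta> (- z))"
  proof -
    have "u2 y2 \<xi> = - (\<beta> * max (- 1) (min 1 (1 / \<beta> * z)))" by (simp add: u2_def z_def sat_eq)
    also have "\<beta> * max (- 1) (min 1 (1 / \<beta> * z)) = max (- \<beta>) (min \<beta> z)"
      using beta_pos by (simp add: max_mult_distrib_left min_mult_distrib_left)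
    finally show ?thesis using beta_pos by (auto simp: max_def min_def)
  qed
  have *: "2 * \<rho> * \<rho> \<le> a * b" if "2 * \<rho> \<le> a" "\<rho> \<le> b" for a b
    using that rho_pos by (intro mult_mono) auto
  consider "\<xi> \<ge> 2 * \<rho>" | "\<xi> \<le> - 2 * \<rho>" using assms by linarith
  then show ?thesis
  proof cases
    case 1
    then have "\<rho> \<le> - u2 y2 \<xi>" using s rho_beta rho_pos unfolding u2 by (auto simp: z_def)
    from *[OF 1 this] show ?thesis by (simp add: power2_eq_square)
  next
    case 2
    then have "2 * \<rho> \<le> - \<xi>" "\<rho> \<le> u2 y2 \<xi>" using s rho_beta rho_pos unfolding u2 by (auto simp: z_def)
    from *[OF this] show ?thesis by (simp add: power2_eq_square)
  qed
qed

text \<open>What is left of the decay after all cross terms are paid. Of the coefficient C1, half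
  pays for y1; of rho, a quarter pays for sin xi - xi and a quarter for the product of xi with
  \<open>sat\<close>. Of the 2 in front of xi^2, xi sin xi takes 1, that same product 1/2, and the
  cross terms in y1 and y2 take 1/8 each.\<close>

definition dissipation :: "real \<Rightarrow> real \<Rightarrow> real \<Rightarrow> real" where
  "dissipation y1 y2 \<xi> = C1 / 2 * (y1 * sat (M * y1)) + \<rho> / 2 * (y2 * sat (C2 * y2)) + \<xi>\<^sup>2 / 4"

section \<open>Estimates for the derivative of the Lyapunov function\<close>

text \<open>The factor of y1 is at most (1 + L) |xi|. Unsaturated damping is quadratic with a
  coefficient fixed by \<open>M\<close> and wins by Young's inequality; saturated damping is linear
  and wins because |xi| <= 2 rho.\<close>

lemma y1_cross_term:
  assumes "\<bar>\<xi>\<bar> \<le> 2 * \<rho>" "\<bar>l\<bar> \<le> L"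
  shows "y1 * (cos \<xi> - 1) - l * y1 * \<xi> \<le> C1 / 2 * (y1 * sat (M * y1)) + \<xi>\<^sup>2 / 8"
proof -
  define q where "q = 1 + L"
  have "q > 0" using L_nonneg by (simp add: q_def)
  have "\<xi>\<^sup>2 \<le> 2 * \<rho> * \<bar>\<xi>\<bar>"
    using mult_right_mono[OF assms(1) abs_ge_zero[of \<xi>]] by (simp add: power2_eq_square)
  then have "\<bar>cos \<xi> - 1\<bar> \<le> \<rho> * \<bar>\<xi>\<bar>" using abs_cos_minus_one_le[of \<xi>] by linarith
  moreover have "\<rho> * \<bar>\<xi>\<bar> \<le> 1 * \<bar>\<xi>\<bar>" using rho_le by (intro mult_right_mono) auto
  moreover have "\<bar>l * \<xi>\<bar> \<le> L * \<bar>\<xi>\<bar>" unfolding abs_mult using assms by (intro mult_right_mono) auto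
  ultimately have "\<bar>(cos \<xi> - 1) - l * \<xi>\<bar> \<le> q * \<bar>\<xi>\<bar>"
    unfolding q_def distrib_right by linarith
  then have "\<bar>y1\<bar> * \<bar>(cos \<xi> - 1) - l * \<xi>\<bar> \<le> \<bar>y1\<bar> * (q * \<bar>\<xi>\<bar>)" by (intro mult_left_mono) auto
  moreover have "y1 * (cos \<xi> - 1) - l * y1 * \<xi> \<le> \<bar>y1\<bar> * \<bar>(cos \<xi> - 1) - l * \<xi>\<bar>"
    unfolding abs_mult[symmetric] by (simp add: algebra_simps)
  ultimately have le: "y1 * (cos \<xi> - 1) - l * y1 * \<xi> \<le> \<bar>y1\<bar> * (q * \<bar>\<xi>\<bar>)" by linarith
  show ?thesis
  proof (cases "M * \<bar>y1\<bar> \<le> 1")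
    case True
    have "C1 / 2 * (y1 * sat (M * y1)) = C1 / 2 * M * y1\<^sup>2"
      using mult_sat_unsaturated[OF M_pos True] by simp
    also have "C1 / 2 * M = 2 * q\<^sup>2" using C1_pos by (simp add: M_def q_def)
    finally have "C1 / 2 * (y1 * sat (M * y1)) = 2 * q\<^sup>2 * y1\<^sup>2" .
    \<comment> \<open>The weight 4 is chosen so that division of the expanded square by 8 leaves
      exactly xi^2 / 8.\<close>
    moreover have "0 \<le> (4 * q * \<bar>y1\<bar> - \<bar>\<xi>\<bar>)\<^sup>2" by simp
    then have "\<bar>y1\<bar> * (q * \<bar>\<xi>\<bar>) \<le> 2 * q\<^sup>2 * y1\<^sup>2 + \<xi>\<^sup>2 / 8"
      by (simp add: power2_diff power_mult_distrib mult_ac)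
    ultimately show ?thesis using le by linarith
  next
    case False
    have "q * \<bar>\<xi>\<bar> \<le> q * (2 * \<rho>)" using \<open>q > 0\<close> assms by (intro mult_left_mono) auto
    also have "\<dots> \<le> C1 / 2" using rho_C1 by (simp add: q_def algebra_simps)
    finally have "\<bar>y1\<bar> * (q * \<bar>\<xi>\<bar>) \<le> \<bar>y1\<bar> * (C1 / 2)" by (intro mult_left_mono) auto
    moreover have "C1 / 2 * (y1 * sat (M * y1)) = \<bar>y1\<bar> * (C1 / 2)"
      using mult_sat_saturated[OF M_pos, of y1] False by simp
    moreover have "0 \<le> \<xi>\<^sup>2 / 8" by simp
    ultimately show ?thesis using le by linarith
  qed
qed

text \<open>Replacing sin xi by xi costs a cubic term. Two of its factors are at most 2 rho, so the
  coefficient of |y2| |xi| becomes 2 rho^2 / 3 <= 1 / 16, small enough in both regimes of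
  \<open>sat\<close>.\<close>

lemma y2_cross_term:
  assumes "\<bar>\<xi>\<bar> \<le> 2 * \<rho>"
  shows "y2 * (sin \<xi> - \<xi>) \<le> \<rho> / 4 * (y2 * sat (C2 * y2)) + \<xi>\<^sup>2 / 8"
proof -
  have "\<xi>\<^sup>2 \<le> (2 * \<rho>)\<^sup>2" using power_mono[OF assms abs_ge_zero, of 2] by (simp only: power2_abs)
  have "\<rho>\<^sup>2 \<le> 1 / 16" using power_mono[OF rho_le, of 2] rho_pos by (simp add: power_divide)
  have "y2 * (sin \<xi> - \<xi>) \<le> \<bar>y2\<bar> * \<bar>sin \<xi> - \<xi>\<bar>" unfolding abs_mult[symmetric] by simp
  also have "\<dots> \<le> \<bar>y2\<bar> * (\<bar>\<xi>\<bar> ^ 3 / 6)" by (intro mult_left_mono abs_sin_minus_id_le) simp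
  also have "\<bar>\<xi>\<bar> ^ 3 = \<xi>\<^sup>2 * \<bar>\<xi>\<bar>" by (simp add: power3_eq_cube power2_eq_square mult_ac)
  also have "\<bar>y2\<bar> * (\<xi>\<^sup>2 * \<bar>\<xi>\<bar> / 6) \<le> \<bar>y2\<bar> * ((2 * \<rho>)\<^sup>2 * \<bar>\<xi>\<bar> / 6)"
    using \<open>\<xi>\<^sup>2 \<le> (2 * \<rho>)\<^sup>2\<close> by (intro mult_left_mono divide_right_mono mult_right_mono) auto
  also have "\<dots> = 2 / 3 * \<rho>\<^sup>2 * (\<bar>y2\<bar> * \<bar>\<xi>\<bar>)" by (simp add: power_mult_distrib)
  also have "\<dots> \<le> 1 / 16 * (\<bar>y2\<bar> * \<bar>\<xi>\<bar>)"
    using \<open>\<rho>\<^sup>2 \<le> 1 / 16\<close> by (intro mult_right_mono) auto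
  finally have le: "y2 * (sin \<xi> - \<xi>) \<le> 1 / 16 * (\<bar>y2\<bar> * \<bar>\<xi>\<bar>)" .
  show ?thesis
  proof (cases "C2 * \<bar>y2\<bar> \<le> 1")
    case True
    have "\<rho> / 4 * (y2 * sat (C2 * y2)) = \<rho> / 4 * C2 * y2\<^sup>2"
      using mult_sat_unsaturated[OF C2_pos True] by simp
    also have "\<rho> / 4 * C2 = 1 / 32" using rho_pos by (simp add: C2_def)
    finally have "\<rho> / 4 * (y2 * sat (C2 * y2)) = 1 / 32 * y2\<^sup>2" .
    moreover have "0 \<le> (\<bar>y2\<bar> - \<bar>\<xi>\<bar>)\<^sup>2" by simp
    then have "\<bar>y2\<bar> * \<bar>\<xi>\<bar> \<le> y2\<^sup>2 / 2 + \<xi>\<^sup>2 / 2" by (simp add: power2_diff)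
    moreover have "0 \<le> \<xi>\<^sup>2" by simp
    ultimately show ?thesis using le by linarith
  next
    case False
    have "1 / 16 * (\<bar>y2\<bar> * \<bar>\<xi>\<bar>) \<le> 1 / 16 * (\<bar>y2\<bar> * (2 * \<rho>))"
      using assms by (intro mult_left_mono) auto
    moreover have "0 \<le> \<rho> * \<bar>y2\<bar>" "0 \<le> \<xi>\<^sup>2" using rho_pos by auto
    moreover have "\<rho> / 4 * (y2 * sat (C2 * y2)) = \<rho> * \<bar>y2\<bar> / 4"
      using mult_sat_saturated[OF C2_pos, of y2] False by simp
    moreover have "1 / 16 * (\<bar>y2\<bar> * (2 * \<rho>)) = \<rho> * \<bar>y2\<bar> / 8" by simp
    ultimately show ?thesis using le by linarith
  qed
qed

text \<open>The left-hand side is the derivative of \<open>V = y1\<^sup>2 / 2 + y2\<^sup>2 / 2 + y2 * \<xi> + \<xi>\<^sup>2\<close>. The cross term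
  \<open>y2 * \<xi>\<close> accounts for the lag of \<open>\<xi>\<close> behind its target \<open>- \<rho> * sat (C2 * y2)\<close> without ever
  differentiating \<^const>\<open>sat\<close>, which would bring in the unbounded \<open>lam t y1 * y1\<close>.\<close>

lemma dissipation_inequality:
  assumes "t \<ge> 0" "\<bar>\<xi>\<bar> \<le> 2 * \<rho>" and v: "field t (y1, y2, \<xi>) = (v1, v2, v3)"
  shows "y1 * v1 + (y2 + \<xi>) * (v2 + v3) + \<xi> * v3 \<le> - dissipation y1 y2 \<xi>"
proof -
  define s1 s2 l where "s1 = sat (M * y1)" and "s2 = sat (C2 * y2)" and "l = lam t y1"
  have v1: "v1 = - C1 * s1 + l * y2 + (cos \<xi> - 1)" and v2: "v2 = sin \<xi> - l * y1"
    and v3: "v3 = - (\<xi> + \<rho> * s2)"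
    using v u2_unsaturated[OF assms(2)] by (auto simp: field_eq s1_def s2_def l_def)
  have "y1 * v1 + (y2 + \<xi>) * (v2 + v3) + \<xi> * v3 =
      - C1 * (y1 * s1) + (y1 * (cos \<xi> - 1) - l * y1 * \<xi>) + y2 * (sin \<xi> - \<xi>) - \<rho> * (y2 * s2)
        + \<xi> * sin \<xi> - 2 * \<xi>\<^sup>2 - 2 * \<rho> * \<xi> * s2"
    by (simp add: v1 v2 v3 power2_eq_square algebra_simps)
  moreover have "\<xi> * sin \<xi> \<le> \<xi>\<^sup>2"
  proof -
    have "\<xi> * sin \<xi> \<le> \<bar>\<xi>\<bar> * \<bar>sin \<xi>\<bar>" unfolding abs_mult[symmetric] by simp
    also have "\<dots> \<le> \<bar>\<xi>\<bar> * \<bar>\<xi>\<bar>" by (intro mult_left_mono abs_sin_x_le_abs_x) simp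
    finally show ?thesis by (simp add: power2_eq_square)
  qed
  \<comment> \<open>Completing the square leaves 2 rho^2 s2^2. One factor s2 is traded for C2 y2, so
    that the remainder is again a multiple of the damping y2 s2.\<close>
  moreover have "- (2 * \<rho> * \<xi> * s2) \<le> \<xi>\<^sup>2 / 2 + \<rho> / 4 * (y2 * s2)"
  proof -
    have "0 \<le> (\<xi> + 2 * \<rho> * s2)\<^sup>2" by simp
    then have "- (2 * \<rho> * \<xi> * s2) \<le> \<xi>\<^sup>2 / 2 + 2 * \<rho>\<^sup>2 * s2\<^sup>2"
      by (simp add: power2_sum power_mult_distrib mult_ac)
    also have "s2\<^sup>2 \<le> C2 * (y2 * s2)" using mult_sat_ge_power2[of "C2 * y2"] by (simp add: s2_def mult_ac)
    then have "2 * \<rho>\<^sup>2 * s2\<^sup>2 \<le> 2 * \<rho>\<^sup>2 * (C2 * (y2 * s2))" by (intro mult_left_mono) auto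
    also have "\<dots> = \<rho> / 4 * (y2 * s2)" using rho_pos by (simp add: C2_def power2_eq_square)
    finally show ?thesis by simp
  qed
  moreover note y1_cross_term[OF assms(2) lam_bound[OF \<open>t \<ge> 0\<close>, of y1], of y1]
    y2_cross_term[OF assms(2), of y2]
  ultimately show ?thesis
    by (simp add: dissipation_def s1_def[symmetric] s2_def[symmetric] l_def[symmetric])
qed

definition lyapunov :: "real \<times> real \<times> real \<Rightarrow> real" where
  "lyapunov x = ((fst x)\<^sup>2 + (fst (snd x) + snd (snd x))\<^sup>2 + (snd (snd x))\<^sup>2) / 2"

lemma norm_triple: "(norm (a, b, c))\<^sup>2 = a\<^sup>2 + b\<^sup>2 + c\<^sup>2" for a b c :: real
  by (simp add: norm_Pair)

text \<open>Explicit sums of squares certify both comparisons of quadratic forms. The product 6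
  (3/2) = 9 is the square of the overshoot factor 3 used for trajectories.\<close>

lemma lyapunov_bounds: "(norm x)\<^sup>2 \<le> 6 * lyapunov x" "lyapunov x \<le> 3 / 2 * (norm x)\<^sup>2"
proof -
  obtain a b c where x: "x = (a, b, c)" by (cases x)
  have "6 * lyapunov x - (norm x)\<^sup>2 = 2 * a\<^sup>2 + (2 * b + 3 * c)\<^sup>2 / 2 + c\<^sup>2 / 2"
    unfolding x norm_triple lyapunov_def fst_conv snd_conv by (simp add: power2_eq_square field_simps)
  moreover have "0 \<le> 2 * a\<^sup>2 + (2 * b + 3 * c)\<^sup>2 / 2 + c\<^sup>2 / 2" by simp
  ultimately show "(norm x)\<^sup>2 \<le> 6 * lyapunov x" by linarith
  have "3 / 2 * (norm x)\<^sup>2 - lyapunov x = a\<^sup>2 + (2 * b - c)\<^sup>2 / 4 + c\<^sup>2 / 4"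
    unfolding x norm_triple lyapunov_def fst_conv snd_conv by (simp add: power2_eq_square field_simps)
  moreover have "0 \<le> a\<^sup>2 + (2 * b - c)\<^sup>2 / 4 + c\<^sup>2 / 4" by simp
  ultimately show "lyapunov x \<le> 3 / 2 * (norm x)\<^sup>2" by linarith
qed

lemma dissipation_lower_bound:
  assumes "R > 0"
  obtains c where "c > 0" "\<And>y1 y2 \<xi>. norm (y1, y2, \<xi>) \<le> R \<Longrightarrow> c * (norm (y1, y2, \<xi>))\<^sup>2 \<le> dissipation y1 y2 \<xi>"
proof -
  define c where "c = min (C1 / 2 * min M (1 / R)) (min (\<rho> / 2 * min C2 (1 / R)) (1 / 4))"
  have c_le: "c \<le> C1 / 2 * min M (1 / R)" "c \<le> \<rho> / 2 * min C2 (1 / R)" "c \<le> 1 / 4"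
    unfolding c_def by (rule min.cobounded1, meson min.cobounded1 min.coboundedI2, meson min.cobounded2 min.coboundedI2)
  have "c > 0" using assms C1_pos M_pos rho_pos C2_pos by (simp add: c_def)
  moreover have "c * (norm (y1, y2, \<xi>))\<^sup>2 \<le> dissipation y1 y2 \<xi>" if "norm (y1, y2, \<xi>) \<le> R" for y1 y2 \<xi>
  proof -
    have "\<bar>y1\<bar> \<le> R" "\<bar>y2\<bar> \<le> R"
      using that norm_fst_le[of y1 "(y2, \<xi>)"] norm_snd_le[of "(y2, \<xi>)" y1] norm_fst_le[of y2 \<xi>] by auto
    have "c * y1\<^sup>2 \<le> C1 / 2 * min M (1 / R) * y1\<^sup>2" by (intro mult_right_mono c_le) simp
    also have "\<dots> \<le> C1 / 2 * (y1 * sat (M * y1))"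
      using mult_left_mono[OF mult_sat_ge_on_bounded[OF M_pos \<open>\<bar>y1\<bar> \<le> R\<close> \<open>R > 0\<close>], of "C1 / 2"] C1_pos by simp
    finally have 1: "c * y1\<^sup>2 \<le> C1 / 2 * (y1 * sat (M * y1))" .
    have "c * y2\<^sup>2 \<le> \<rho> / 2 * min C2 (1 / R) * y2\<^sup>2" by (intro mult_right_mono c_le) simp
    also have "\<dots> \<le> \<rho> / 2 * (y2 * sat (C2 * y2))"
      using mult_left_mono[OF mult_sat_ge_on_bounded[OF C2_pos \<open>\<bar>y2\<bar> \<le> R\<close> \<open>R > 0\<close>], of "\<rho> / 2"] rho_pos by simp
    finally have 2: "c * y2\<^sup>2 \<le> \<rho> / 2 * (y2 * sat (C2 * y2))" .
    have "c * \<xi>\<^sup>2 \<le> 1 / 4 * \<xi>\<^sup>2" by (intro mult_right_mono c_le) simp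
    with 1 2 show ?thesis by (simp add: norm_triple dissipation_def algebra_simps)
  qed
  ultimately show ?thesis by (rule that)
qed

section \<open>From differential inequalities to statements about trajectories\<close>

lemma abs_continuous_on_xi_power2:
  assumes "abs_continuous_on {a..b} x"
  shows "abs_continuous_on {a..b} (\<lambda>t. (snd (snd (x t)) :: real)\<^sup>2)"
proof -
  obtain B where "\<And>t. t \<in> {a..b} \<Longrightarrow> norm (x t) \<le> B" using abs_continuous_on_bounded[OF assms] by blast
  then have "\<bar>snd (snd (x t))\<bar> \<le> B" if "t \<in> {a..b}" for t
    using that norm_snd_snd_le[of "x t"] by (metis order_trans real_norm_def)
  then show ?thesis
    by (intro abs_continuous_on_power2[of _ _ B] abs_continuous_on_compose_bounded_linear[OF _ assms]
        bounded_linear_snd_comp bounded_linear_snd)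
qed

lemma abs_continuous_on_lyapunov:
  assumes "abs_continuous_on {a..b} x"
  shows "abs_continuous_on {a..b} (\<lambda>t. lyapunov (x t))"
proof -
  obtain B where B: "\<And>t. t \<in> {a..b} \<Longrightarrow> norm (x t) \<le> B" using abs_continuous_on_bounded[OF assms] by blast
  have sq: "abs_continuous_on {a..b} (\<lambda>t. (h (x t))\<^sup>2)" if h: "bounded_linear h" for h :: "_ \<Rightarrow> real"
  proof -
    have ac: "abs_continuous_on {a..b} (\<lambda>t. h (x t))"
      by (rule abs_continuous_on_compose_bounded_linear[OF h assms])
    obtain B' where "\<And>t. t \<in> {a..b} \<Longrightarrow> norm (h (x t)) \<le> B'" using abs_continuous_on_bounded[OF ac] by blast
    then show ?thesis by (intro abs_continuous_on_power2[OF ac, of B']) auto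
  qed
  have bl: "bounded_linear (\<lambda>x::real \<times> real \<times> real. fst x)"
    "bounded_linear (\<lambda>x::real \<times> real \<times> real. snd (snd x))"
    "bounded_linear (\<lambda>x::real \<times> real \<times> real. fst (snd x) + snd (snd x))"
    by (intro bounded_linear_add bounded_linear_fst_comp bounded_linear_snd_comp bounded_linear_fst
        bounded_linear_snd bounded_linear_ident)+
  show ?thesis
    unfolding lyapunov_def
    by (intro abs_continuous_on_compose_bounded_linear[OF bounded_linear_divide] abs_continuous_on_add sq bl)
qed

text \<open>The square of xi is used because it is differentiable wherever xi is. The hypothesis
  \<open>far\<close> omits the left end point, so the interval may start at the last instant inside
  the strip; that point is simply added to the null set.\<close>

lemma xi_power2_decrease:
  assumes "0 \<le> \<tau>" and x: "caratheodory_solution field {\<tau>..} x" and "\<tau> \<le> a" "a \<le> b"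
    and far: "\<And>t. t \<in> {a<..b} \<Longrightarrow> \<bar>snd (snd (x t))\<bar> \<ge> 2 * \<rho>"
  shows "(snd (snd (x b)))\<^sup>2 - (snd (snd (x a)))\<^sup>2 \<le> - 4 * \<rho>\<^sup>2 * (b - a)"
proof -
  have sub: "{a..b} \<subseteq> {\<tau>..}" using \<open>\<tau> \<le> a\<close> by auto
  obtain N where "negligible N"
    "\<And>t a b. t \<in> {a..b} - N \<Longrightarrow> {a..b} \<subseteq> {\<tau>..} \<Longrightarrow> (x has_vector_derivative field t (x t)) (at t within {a..b})"
    using caratheodory_solution_null_set[OF x] by blast
  note N = this(1) this(2)[OF _ sub]
  have "abs_continuous_on {a..b} x" using x sub unfolding caratheodory_solution_def by blast
  then have "abs_continuous_on {a..b} (\<lambda>t. (snd (snd (x t)))\<^sup>2)" by (rule abs_continuous_on_xi_power2)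
  moreover have "negligible (insert a N)" using N(1) by simp
  ultimately show ?thesis
  proof (rule abs_continuous_on_derivative_le[OF \<open>a \<le> b\<close>])
    fix t assume t: "t \<in> {a..b} - insert a N"
    obtain y1 y2 \<xi> where xt: "x t = (y1, y2, \<xi>)" by (cases "x t")
    have "(x has_vector_derivative field t (x t)) (at t within {a..b})" using N(2) t by blast
    then have "((\<lambda>t. snd (snd (x t))) has_vector_derivative snd (snd (field t (x t)))) (at t within {a..b})"
      by (intro bounded_linear.has_vector_derivative[OF bounded_linear_snd])
    then have "((\<lambda>t. snd (snd (x t))) has_real_derivative u2 y2 \<xi>) (at t within {a..b})"
      by (simp add: has_real_derivative_iff_has_vector_derivative xt field_eq)
    then have "((\<lambda>t. (snd (snd (x t)))\<^sup>2) has_real_derivative 2 * (\<xi> * u2 y2 \<xi>)) (at t within {a..b})"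
      by (auto intro!: derivative_eq_intros simp: xt)
    moreover have "2 * (\<xi> * u2 y2 \<xi>) \<le> - 4 * \<rho>\<^sup>2"
      using u2_contracting[of \<xi> y2] far[of t] t by (simp add: xt)
    ultimately show "\<exists>D\<le>- 4 * \<rho>\<^sup>2. ((\<lambda>t. (snd (snd (x t)))\<^sup>2) has_vector_derivative D) (at t within {a..b})"
      using has_real_derivative_iff_has_vector_derivative by blast
  qed
qed

text \<open>After the last time \<open>s\<close> at which |xi| <= 2 rho, the square of xi can only
  decrease, so the strip could not have been left.\<close>

lemma xi_invariant:
  assumes "0 \<le> \<tau>" and x: "caratheodory_solution field {\<tau>..} x" and "\<tau> \<le> a" "a \<le> b"
    and a: "\<bar>snd (snd (x a))\<bar> \<le> 2 * \<rho>"
  shows "\<bar>snd (snd (x b))\<bar> \<le> 2 * \<rho>"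
proof (rule ccontr)
  assume far: "\<not> \<bar>snd (snd (x b))\<bar> \<le> 2 * \<rho>"
  define S where "S = {a..b} \<inter> (\<lambda>t. \<bar>snd (snd (x t))\<bar>) -` {..2 * \<rho>}"
  have "{a..b} \<subseteq> {\<tau>..}" using \<open>\<tau> \<le> a\<close> by auto
  then have "abs_continuous_on {a..b} x" using x unfolding caratheodory_solution_def by blast
  then have "continuous_on {a..b} (\<lambda>t. \<bar>snd (snd (x t))\<bar>)"
    by (intro continuous_intros abs_continuous_on_imp_continuous_on)
  then have "closed S" unfolding S_def by (rule continuous_closed_preimage) auto
  then have "compact S" by (simp add: S_def compact_eq_bounded_closed bounded_Int)
  moreover have "a \<in> S" using a \<open>a \<le> b\<close> by (simp add: S_def)
  ultimately obtain s where "s \<in> S" and s_max: "\<And>t. t \<in> S \<Longrightarrow> t \<le> s"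
    using compact_attains_sup[of S] by blast
  then have s: "s \<in> {a..b}" "\<bar>snd (snd (x s))\<bar> \<le> 2 * \<rho>" by (auto simp: S_def)
  have last: "t \<le> s" if "t \<in> {a..b}" "\<bar>snd (snd (x t))\<bar> \<le> 2 * \<rho>" for t
    using s_max that by (simp add: S_def)
  have "(snd (snd (x b)))\<^sup>2 - (snd (snd (x s)))\<^sup>2 \<le> - 4 * \<rho>\<^sup>2 * (b - s)"
  proof (rule xi_power2_decrease[OF assms(1) x])
    fix t assume "t \<in> {s<..b}"
    then show "2 * \<rho> \<le> \<bar>snd (snd (x t))\<bar>" using last[of t] s(1) by force
  qed (use s \<open>\<tau> \<le> a\<close> in auto)
  also have "\<dots> \<le> 0" using s by simp
  finally have "\<bar>snd (snd (x b))\<bar> \<le> \<bar>snd (snd (x s))\<bar>" by (simp add: abs_le_square_iff)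
  with s far show False by linarith
qed

lemma xi_entry:
  assumes "0 \<le> \<tau>" and x: "caratheodory_solution field {\<tau>..} x"
  obtains T where "T \<ge> \<tau>" "\<bar>snd (snd (x T))\<bar> \<le> 2 * \<rho>"
proof (rule ccontr)
  assume "\<not> thesis"
  with that have far: "\<And>t. t \<ge> \<tau> \<Longrightarrow> \<bar>snd (snd (x t))\<bar> > 2 * \<rho>" by (meson not_le)
  \<comment> \<open>The time at which a decrease at rate 4 rho^2 would have exhausted the initial
    value of xi^2.\<close>
  define T where "T = \<tau> + (snd (snd (x \<tau>)))\<^sup>2 / (4 * \<rho>\<^sup>2)"
  have "\<tau> \<le> T" by (simp add: T_def)
  have "(snd (snd (x T)))\<^sup>2 - (snd (snd (x \<tau>)))\<^sup>2 \<le> - 4 * \<rho>\<^sup>2 * (T - \<tau>)"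
    by (rule xi_power2_decrease[OF assms]) (use far \<open>\<tau> \<le> T\<close> in \<open>auto simp: less_imp_le\<close>)
  also have "\<dots> = - (snd (snd (x \<tau>)))\<^sup>2" using rho_pos by (simp add: T_def)
  finally have "snd (snd (x T)) = 0" by simp
  then show False using far[OF \<open>\<tau> \<le> T\<close>] rho_pos by simp
qed

text \<open>Invariance of the strip makes the dissipation inequality available on all of [a, b]. The
  parameter \<open>m\<close> is 0 for monotonicity and positive for attractivity.\<close>

lemma lyapunov_decrease:
  assumes "0 \<le> \<tau>" and x: "caratheodory_solution field {\<tau>..} x" and "\<tau> \<le> a" "a \<le> b"
    and a: "\<bar>snd (snd (x a))\<bar> \<le> 2 * \<rho>"
    and diss: "\<And>t y1 y2 \<xi>. t \<in> {a..b} \<Longrightarrow> x t = (y1, y2, \<xi>) \<Longrightarrow> m \<le> dissipation y1 y2 \<xi>"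
  shows "lyapunov (x b) - lyapunov (x a) \<le> - m * (b - a)"
proof -
  have sub: "{a..b} \<subseteq> {\<tau>..}" using \<open>\<tau> \<le> a\<close> by auto
  obtain N where "negligible N"
    "\<And>t a b. t \<in> {a..b} - N \<Longrightarrow> {a..b} \<subseteq> {\<tau>..} \<Longrightarrow> (x has_vector_derivative field t (x t)) (at t within {a..b})"
    using caratheodory_solution_null_set[OF x] by blast
  note N = this(1) this(2)[OF _ sub]
  have "abs_continuous_on {a..b} x" using x sub unfolding caratheodory_solution_def by blast
  then have "abs_continuous_on {a..b} (\<lambda>t. lyapunov (x t))" by (rule abs_continuous_on_lyapunov)
  then show ?thesis
  proof (rule abs_continuous_on_derivative_le[OF \<open>a \<le> b\<close> _ N(1)])
    fix t assume t: "t \<in> {a..b} - N"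
    obtain y1 y2 \<xi> where xt: "x t = (y1, y2, \<xi>)" by (cases "x t")
    obtain v1 v2 v3 where v: "field t (y1, y2, \<xi>) = (v1, v2, v3)" by (cases "field t (y1, y2, \<xi>)")
    have "(x has_vector_derivative (v1, v2, v3)) (at t within {a..b})" using N(2) t v by (metis xt)
    note snd = bounded_linear.has_vector_derivative[OF bounded_linear_snd this]
    have d: "((\<lambda>t. fst (x t)) has_real_derivative v1) (at t within {a..b})"
      "((\<lambda>t. fst (snd (x t))) has_real_derivative v2) (at t within {a..b})"
      "((\<lambda>t. snd (snd (x t))) has_real_derivative v3) (at t within {a..b})"
      using bounded_linear.has_vector_derivative[OF bounded_linear_fst
          \<open>(x has_vector_derivative (v1, v2, v3)) (at t within {a..b})\<close>]
        bounded_linear.has_vector_derivative[OF bounded_linear_fst snd]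
        bounded_linear.has_vector_derivative[OF bounded_linear_snd snd]
      by (simp_all add: has_real_derivative_iff_has_vector_derivative)
    have "((\<lambda>t. lyapunov (x t)) has_real_derivative y1 * v1 + (y2 + \<xi>) * (v2 + v3) + \<xi> * v3) (at t within {a..b})"
      unfolding lyapunov_def by (auto intro!: derivative_eq_intros d simp: xt field_simps)
    moreover have "y1 * v1 + (y2 + \<xi>) * (v2 + v3) + \<xi> * v3 \<le> - m"
    proof -
      have "\<bar>snd (snd (x t))\<bar> \<le> 2 * \<rho>"
        by (rule xi_invariant[OF assms(1) x \<open>\<tau> \<le> a\<close> _ a]) (use t in auto)
      then have "y1 * v1 + (y2 + \<xi>) * (v2 + v3) + \<xi> * v3 \<le> - dissipation y1 y2 \<xi>"
        by (intro dissipation_inequality[OF _ _ v]) (use t assms xt in auto)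
      then show ?thesis using diss[OF _ xt] t by force
    qed
    ultimately show "\<exists>D\<le>- m. ((\<lambda>t. lyapunov (x t)) has_vector_derivative D) (at t within {a..b})"
      using has_real_derivative_iff_has_vector_derivative by blast
  qed
qed

lemma dissipation_nonneg: "0 \<le> dissipation y1 y2 \<xi>"
  using mult_sat_nonneg[OF M_pos] mult_sat_nonneg[OF C2_pos] C1_pos rho_pos
  by (simp add: dissipation_def)

lemma lyapunov_antimono:
  assumes "0 \<le> \<tau>" and x: "caratheodory_solution field {\<tau>..} x" and "\<tau> \<le> a" "a \<le> b"
    and a: "\<bar>snd (snd (x a))\<bar> \<le> 2 * \<rho>"
  shows "lyapunov (x b) \<le> lyapunov (x a)"
  using lyapunov_decrease[OF assms, of 0] dissipation_nonneg by simp

lemma norm_le_3_times_norm: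
  assumes "0 \<le> \<tau>" and x: "caratheodory_solution field {\<tau>..} x" and "\<tau> \<le> a" "a \<le> b"
    and a: "\<bar>snd (snd (x a))\<bar> \<le> 2 * \<rho>"
  shows "norm (x b) \<le> 3 * norm (x a)"
proof (rule power2_le_imp_le)
  show "(norm (x b))\<^sup>2 \<le> (3 * norm (x a))\<^sup>2"
    using lyapunov_antimono[OF assms] lyapunov_bounds(1)[of "x b"] lyapunov_bounds(2)[of "x a"]
    by (simp add: power_mult_distrib)
qed simp

lemma lyapunov_stable_field: "lyapunov_stable field"
  unfolding lyapunov_stable_def
proof (intro allI impI)
  fix \<tau> \<epsilon> :: real assume "0 \<le> \<tau>" "0 < \<epsilon>"
  show "\<exists>\<delta>>0. \<forall>x. caratheodory_solution field {\<tau>..} x \<longrightarrow>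
      norm (x \<tau>) < \<delta> \<longrightarrow> (\<forall>t\<ge>\<tau>. norm (x t) < \<epsilon>)"
  proof (intro exI conjI allI impI)
    \<comment> \<open>The bound 2 rho starts the trajectory inside the strip, so there is no
      transient; \<open>\<epsilon> / 3\<close> offsets the overshoot factor 3.\<close>
    show "0 < min (\<epsilon> / 3) (2 * \<rho>)" using \<open>0 < \<epsilon>\<close> rho_pos by simp
    fix x t assume x: "caratheodory_solution field {\<tau>..} x" "norm (x \<tau>) < min (\<epsilon> / 3) (2 * \<rho>)" "\<tau> \<le> t"
    then have "\<bar>snd (snd (x \<tau>))\<bar> \<le> 2 * \<rho>" using norm_snd_snd_le[of "x \<tau>"] by simp
    then have "norm (x t) \<le> 3 * norm (x \<tau>)"
      using norm_le_3_times_norm[OF \<open>0 \<le> \<tau>\<close> x(1)] x(3) by simp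
    then show "norm (x t) < \<epsilon>" using x(2) by simp
  qed
qed

lemma globally_attractive_field: "globally_attractive field"
  unfolding globally_attractive_def
proof (intro allI impI)
  fix \<tau> :: real and x assume "0 \<le> \<tau>" and x: "caratheodory_solution field {\<tau>..} x"
  obtain T where T: "T \<ge> \<tau>" "\<bar>snd (snd (x T))\<bar> \<le> 2 * \<rho>" using xi_entry[OF \<open>0 \<le> \<tau>\<close> x] .
  have inv: "\<bar>snd (snd (x t))\<bar> \<le> 2 * \<rho>" if "T \<le> t" for t
    using xi_invariant[OF \<open>0 \<le> \<tau>\<close> x T(1) that T(2)] .
  \<comment> \<open>The overshoot bound after entry into the strip; the summand 1 keeps it positive
    at the origin.\<close>
  define R where "R = 3 * norm (x T) + 1"
  have "R > 0" using norm_ge_zero[of "x T"] unfolding R_def by linarith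
  have R: "norm (x t) \<le> R" if "T \<le> t" for t
    using norm_le_3_times_norm[OF \<open>0 \<le> \<tau>\<close> x T(1) that T(2)] by (simp add: R_def)
  obtain c where c: "c > 0"
    "\<And>y1 y2 \<xi>. norm (y1, y2, \<xi>) \<le> R \<Longrightarrow> c * (norm (y1, y2, \<xi>))\<^sup>2 \<le> dissipation y1 y2 \<xi>"
    using dissipation_lower_bound[OF \<open>R > 0\<close>] by blast
  \<comment> \<open>One visit below each level suffices, because monotonicity then keeps the
    Lyapunov function there. If it stayed above \<open>\<eta>\<close>, the squared norm would be at
    least 2 \<open>\<eta>\<close> / 3, and by time \<open>S\<close> the guaranteed decrease would
    have used up its whole initial value.\<close>
  have small: "\<exists>t\<ge>T. lyapunov (x t) < \<eta>" if "\<eta> > 0" for \<eta>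
  proof (rule ccontr)
    assume "\<not> ?thesis"
    then have large: "\<And>t. t \<ge> T \<Longrightarrow> \<eta> \<le> lyapunov (x t)" by (meson not_le)
    define S where "S = T + lyapunov (x T) / (c * (2 / 3 * \<eta>))"
    have "T \<le> S" using large[of T] \<open>\<eta> > 0\<close> c(1) by (simp add: S_def)
    have "lyapunov (x S) - lyapunov (x T) \<le> - (c * (2 / 3 * \<eta>)) * (S - T)"
    proof (rule lyapunov_decrease[OF \<open>0 \<le> \<tau>\<close> x T(1) \<open>T \<le> S\<close> T(2)])
      fix t y1 y2 \<xi> assume t: "t \<in> {T..S}" and xt: "x t = (y1, y2, \<xi>)"
      have "2 / 3 * \<eta> \<le> (norm (x t))\<^sup>2" using large[of t] lyapunov_bounds(2)[of "x t"] t by simp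
      then have "c * (2 / 3 * \<eta>) \<le> c * (norm (x t))\<^sup>2" using c(1) by (intro mult_left_mono) auto
      also have "\<dots> \<le> dissipation y1 y2 \<xi>" using c(2) R[of t] t by (simp add: xt)
      finally show "c * (2 / 3 * \<eta>) \<le> dissipation y1 y2 \<xi>" .
    qed
    also have "\<dots> = - lyapunov (x T)" using c(1) \<open>\<eta> > 0\<close> by (simp add: S_def)
    finally show False using large[OF \<open>T \<le> S\<close>] \<open>\<eta> > 0\<close> by simp
  qed
  show "(x \<longlongrightarrow> 0) at_top"
  proof (rule tendstoI)
    fix \<epsilon> :: real assume "\<epsilon> > 0"
    then obtain s where s: "s \<ge> T" "lyapunov (x s) < \<epsilon>\<^sup>2 / 6" using small[of "\<epsilon>\<^sup>2 / 6"] by auto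
    have "dist (x t) 0 < \<epsilon>" if "s \<le> t" for t
    proof -
      have "lyapunov (x t) \<le> lyapunov (x s)"
        by (rule lyapunov_antimono[OF \<open>0 \<le> \<tau>\<close> x _ that inv[OF s(1)]]) (use T s in simp)
      then have "(norm (x t))\<^sup>2 < \<epsilon>\<^sup>2" using lyapunov_bounds(1)[of "x t"] s(2) by simp
      then show ?thesis using \<open>\<epsilon> > 0\<close> by (simp add: power2_less_imp_less)
    qed
    then show "\<forall>\<^sub>F t in at_top. dist (x t) 0 < \<epsilon>" using eventually_at_top_linorder by blast
  qed
qed

lemma globally_asymptotically_stable_field:
  assumes "\<kappa> \<in> borel_measurable (lebesgue_on {0..})"
  shows "globally_asymptotically_stable field"
proof -
  interpret caratheodory_field field "3 + C1 + \<beta>" "2 * ((1 + C1) * k) + 1"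
    by (rule closed_loop_caratheodory_field)
      (use C1_pos beta_pos M_pos C2_pos rho_pos k_nonneg assms kappa_bound in auto)
  show ?thesis
    unfolding globally_asymptotically_stable_def
    using forward_complete lyapunov_stable_field globally_attractive_field by blast
qed

end

theorem theorem1:
  fixes d \<kappa>max \<beta>M C1 \<beta> :: real
  assumes "d > 0" and "\<kappa>max \<ge> 0" and "d * \<kappa>max < 1"
    and "\<beta>M = (1 - d * \<kappa>max) / d"
    and "0 < C1" and "C1 \<le> d * \<beta>M / 2"
    and "0 < \<beta>" and "\<beta> \<le> \<beta>M / 2"
  shows "\<exists>M C0 C2 \<rho>. M > 0 \<and> C0 > 0 \<and> C2 > 0 \<and> \<rho> > 0 \<and>
    (\<forall>\<kappa> :: real \<Rightarrow> real.
       \<kappa> \<in> borel_measurable (lebesgue_on {0..}) \<longrightarrow> (\<forall>t\<ge>0. \<bar>\<kappa> t\<bar> \<le> \<kappa>max) \<longrightarrow>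
       globally_asymptotically_stable (closed_loop C1 \<beta> M C0 C2 \<rho> \<kappa>))"
proof -
  define L where "L = (1 + C1) * \<kappa>max"
  \<comment> \<open>The largest value allowed by the three upper bounds on rho in
    \<open>path_following\<close>. It depends on \<open>\<kappa>max\<close>, but not on the
    individual curvature function.\<close>
  define \<rho> where "\<rho> = min (1 / 4) (min (\<beta> / 3) (C1 / (4 * (1 + L))))"
  define C2 where "C2 = 1 / (8 * \<rho>)"
  define M where "M = 4 * (1 + L)\<^sup>2 / C1"
  have "L \<ge> 0" using assms by (simp add: L_def)
  then have "\<rho> > 0" using assms by (simp add: \<rho>_def)
  have "\<rho> \<le> C1 / (4 * (1 + L))" unfolding \<rho>_def by (meson min.cobounded2 min.coboundedI2)
  then have "4 * \<rho> * (1 + L) \<le> C1" using \<open>L \<ge> 0\<close> by (simp add: field_simps)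
  moreover have "\<rho> \<le> \<beta> / 3" unfolding \<rho>_def by (meson min.cobounded1 min.coboundedI2)
  then have "3 * \<rho> \<le> \<beta>" by simp
  moreover have "\<rho> \<le> 1 / 4" unfolding \<rho>_def by (rule min.cobounded1)
  ultimately have "path_following C1 \<beta> L \<rho> C2 M \<kappa>max \<kappa>" if "\<forall>t\<ge>0. \<bar>\<kappa> t\<bar> \<le> \<kappa>max" for \<kappa>
    using assms \<open>\<rho> > 0\<close> that by unfold_locales (auto simp: L_def C2_def M_def)
  then have "globally_asymptotically_stable (closed_loop C1 \<beta> M 1 C2 \<rho> \<kappa>)"
    if "\<kappa> \<in> borel_measurable (lebesgue_on {0..})" "\<forall>t\<ge>0. \<bar>\<kappa> t\<bar> \<le> \<kappa>max" for \<kappa>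
    using path_following.globally_asymptotically_stable_field that by blast
  moreover have "M > 0" "C2 > 0" using assms \<open>L \<ge> 0\<close> \<open>\<rho> > 0\<close> by (auto simp: M_def C2_def)
  ultimately show ?thesis using \<open>\<rho> > 0\<close> zero_less_one by blast
qed

end
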